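(* Let $F$ be a field and let $n$ and $r$ be integers such that $1\leq r<2n$. For integers $k$ and $l$ such that $\max\{0,r-n\}\leq k\leq \min\{r,n\}$ and $\max\{0,r-n\}\leq l\leq \min\{k,r-k\}$ define $w_{k,l}\in GL_{2n}(F)$ by $$w_{k,l}=\begin{bmatrix} I_k & 0& 0& 0&0 &0 \\ 0&0 & 0& I_{n-k}&0 & 0\\ 0& I_l &0 &0 &0 &0 \\ 0&0 &0 &0 & I_{k-l}&0 \\ 0& 0& I_{r-(k+l)}&0 &0 &0 \\ 0& 0&0 &0 &0 & I_{n-r+l} \end{bmatrix}.$$ Then $$\left\{w_{k,l}: \max\{0,r-n\}\leq k \leq \min\{r,n\},\ \max\{0,r-n\}\leq l \leq \min\{k,r-k\} \right\}$$ is a complete set of $(S,P_{r,2n-r})$-double coset representatives in $GL_{2n}(F)$.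
   Context: $\mathcal{M}_{m,n}(F)$ denotes the space of $m\times n$ matrices over $F$, $\mathcal{M}_n(F)=\mathcal{M}_{n,n}(F)$, and $I_m$ is the identity matrix of order $m$ (blocks of size $0$ are omitted). The maximal standard parabolic subgroup of $GL_{2n}(F)$ associated to $(r,2n-r)$ is $$P_{r,2n-r} = \left\{ \begin{pmatrix} g_1 & x\\ 0 & g_2 \end{pmatrix} : g_1 \in GL_r(F),\ g_2 \in GL_{2n-r}(F),\ x \in \mathcal{M}_{r,2n-r}(F) \right\}.$$ The Shalika subgroup of $GL_{2n}(F)$ is $$S = \left\{ \begin{pmatrix} g & x\\ 0 & g \end{pmatrix} : g \in GL_n(F),\ x \in \mathcal{M}_n(F)\right\}.$$ For subgroups $H,K$ of a group $G$, a subset $C\subset G$ is a complete set of $(H,K)$-double coset representatives in $G$ if $G$ is the disjoint union of the double cosets $HgK$, $g\in C$. *)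

theory Defs
  imports
    "Jordan_Normal_Form.Matrix"
    "HOL-Algebra.Coset"
    "HOL-Library.Disjoint_Sets"
begin

definition GL :: "'a::field itself \<Rightarrow> nat \<Rightarrow> 'a mat monoid" where
  "GL ty n = units_of (ring_mat ty n ())"

definition parabolic_subgroup :: "'a::field itself \<Rightarrow> nat \<Rightarrow> nat \<Rightarrow> 'a mat set" where
  "parabolic_subgroup ty r m =
     {four_block_mat g1 x (0\<^sub>m m r) g2 | g1 x g2.
        g1 \<in> carrier (GL ty r) \<and> g2 \<in> carrier (GL ty m) \<and> x \<in> carrier_mat r m}"

definition shalika_subgroup :: "'a::field itself \<Rightarrow> nat \<Rightarrow> 'a mat set" where
  "shalika_subgroup ty n =
     {four_block_mat g x (0\<^sub>m n n) g | g x. g \<in> carrier (GL ty n) \<and> x \<in> carrier_mat n n}"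

definition double_coset :: "('a, 'b) monoid_scheme \<Rightarrow> 'a set \<Rightarrow> 'a \<Rightarrow> 'a set \<Rightarrow> 'a set" where
  "double_coset G H g K = (H #>\<^bsub>G\<^esub> g) <#>\<^bsub>G\<^esub> K"

text \<open>The notion presupposes that \<open>G\<close> is a group and that \<open>H\<close>, \<open>K\<close> are subgroups of it, so
  these are part of the predicate.\<close>

definition complete_double_coset_reps ::
  "('a, 'b) monoid_scheme \<Rightarrow> 'a set \<Rightarrow> 'a set \<Rightarrow> 'a set \<Rightarrow> bool" where
  "complete_double_coset_reps G H K C \<longleftrightarrow>
     group G \<and> subgroup H G \<and> subgroup K G \<and> C \<subseteq> carrier G \<and>
     carrier G = (\<Union>g\<in>C. double_coset G H g K) \<and>
     disjoint_family_on (\<lambda>g. double_coset G H g K) C"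

text \<open>Horizontal juxtaposition, the counterpart of \<^const>\<open>append_rows\<close>. It binds tighter, so that
  a block matrix can be written row by row.\<close>

definition append_cols :: "'a::zero mat \<Rightarrow> 'a mat \<Rightarrow> 'a mat" (infixr \<open>@\<^sub>c\<close> 66) where
  "append_cols A B = four_block_mat A B (0\<^sub>m 0 (dim_col A)) (0\<^sub>m 0 (dim_col B))"

text \<open>Block rows have heights \<open>k, n-k, l, k-l, r-(k+l), n-r+l\<close> and block columns have widths
  \<open>k, l, r-(k+l), n-k, k-l, n-r+l\<close>. The last size is written \<^term>\<open>n + l - r\<close>: subtraction on
  \<^typ>\<open>nat\<close> truncates, and \<open>n < r\<close> may occur.\<close>

definition w_mat :: "'a::field itself \<Rightarrow> nat \<Rightarrow> nat \<Rightarrow> nat \<Rightarrow> nat \<Rightarrow> 'a mat" where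
  "w_mat ty n r k l =
    (let a = k; b = l; c = r - (k + l); d = n - k; e = k - l; f = n + l - r in
     1\<^sub>m a   @\<^sub>c 0\<^sub>m a b @\<^sub>c 0\<^sub>m a c @\<^sub>c 0\<^sub>m a d @\<^sub>c 0\<^sub>m a e @\<^sub>c 0\<^sub>m a f @\<^sub>r
     0\<^sub>m d a @\<^sub>c 0\<^sub>m d b @\<^sub>c 0\<^sub>m d c @\<^sub>c 1\<^sub>m d   @\<^sub>c 0\<^sub>m d e @\<^sub>c 0\<^sub>m d f @\<^sub>r
     0\<^sub>m b a @\<^sub>c 1\<^sub>m b   @\<^sub>c 0\<^sub>m b c @\<^sub>c 0\<^sub>m b d @\<^sub>c 0\<^sub>m b e @\<^sub>c 0\<^sub>m b f @\<^sub>r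
     0\<^sub>m e a @\<^sub>c 0\<^sub>m e b @\<^sub>c 0\<^sub>m e c @\<^sub>c 0\<^sub>m e d @\<^sub>c 1\<^sub>m e   @\<^sub>c 0\<^sub>m e f @\<^sub>r
     0\<^sub>m c a @\<^sub>c 0\<^sub>m c b @\<^sub>c 1\<^sub>m c   @\<^sub>c 0\<^sub>m c d @\<^sub>c 0\<^sub>m c e @\<^sub>c 0\<^sub>m c f @\<^sub>r
     0\<^sub>m f a @\<^sub>c 0\<^sub>m f b @\<^sub>c 0\<^sub>m f c @\<^sub>c 0\<^sub>m f d @\<^sub>c 0\<^sub>m f e @\<^sub>c 1\<^sub>m f)"

end

theory Submission
  imports Defs "Jordan_Normal_Form.Determinant" "Jordan_Normal_Form.Column_Operations"
begin

text \<open>The coset \<open>g P\<close> is determined by the span of the first \<open>r\<close> columns of \<open>g\<close>, and the Shalika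
  group is the centralizer of the nilpotent \<open>N = (0 1; 0 0)\<close>. So the double cosets are the orbits of
  that centralizer on the \<open>r\<close>-dimensional subspaces \<open>W\<close> of \<open>F\<^sup>n \<oplus> F\<^sup>n\<close>. Let \<open>A\<close> be the intersection of
  \<open>W\<close> with the first summand and \<open>B\<close> its projection to the second one. The unipotent part of
  the Shalika group makes \<open>W\<close> equal to \<open>A \<oplus> B\<close>, and what is left is the action of \<open>GL\<^sub>n\<close> on pairs of
  subspaces of \<open>F\<^sup>n\<close>, whose orbits are given by \<open>k = dim A\<close>, \<open>r - k = dim B\<close> and
  \<open>l = dim (A \<inter> B)\<close>. Conversely \<open>dim (N W) = r - k\<close> and \<open>dim (W + N W) = 2 r - k - l\<close> are
  invariants of the orbit.\<close>

text \<open>A subspace is handled through a basis: a matrix with a left inverse, taken up to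
  \<open>GL\<close> acting on its columns. Left inverses stand in for linear independence, so the
  steps become block matrix identities. The obstacle is that the same g acts on both summands, so A
  and B cannot be normalized separately: once A is standard, B may be moved only by the stabilizer
  of A, which consists of block upper triangular matrices. Normalizing the pair is thus again a
  splitting problem, now of B along A in place of W along the first summand, and one splitting lemma
  serves both. The bounds on l say that A \<inter> B lies in A and in B and that dim (A + B) = r - l
  is at most n. For W = A \<oplus> B the space N W is B moved into the first summand and W + N W is
  (A + B) \<oplus> B, whence the dimensions r - k and (r - l) + (r - k).\<close>

section \<open>The general linear group\<close>

lemma GL_iff: "A \<in> carrier (GL TYPE('a::field) n) \<longleftrightarrow> A \<in> carrier_mat n n \<and> det A \<noteq> 0"
proof
  assume "A \<in> carrier (GL TYPE('a) n)"
  then have U: "A \<in> Units (ring_mat TYPE('a) n ())"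
    by (simp add: GL_def units_of_carrier)
  then show "A \<in> carrier_mat n n \<and> det A \<noteq> 0"
    using unit_imp_det_non_zero[OF U] by (simp add: Units_def ring_mat_simps)
next
  assume "A \<in> carrier_mat n n \<and> det A \<noteq> 0"
  then show "A \<in> carrier (GL TYPE('a) n)"
    by (simp add: GL_def units_of_carrier det_non_zero_imp_unit)
qed

lemma GL_simps:
  "mult (GL TYPE('a::field) n) = (*)" "one (GL TYPE('a) n) = 1\<^sub>m n"
  by (simp_all add: GL_def units_of_mult units_of_one ring_mat_simps)

lemma group_GL: "group (GL TYPE('a::field) n)"
proof -
  interpret ring "ring_mat TYPE('a) n ()" by (rule ring_mat)
  show ?thesis unfolding GL_def by (rule units_group)
qed

lemma GL_carrier: "A \<in> carrier (GL TYPE('a::field) n) \<Longrightarrow> A \<in> carrier_mat n n"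
  by (simp add: GL_iff)

lemma one_GL: "1\<^sub>m n \<in> carrier (GL TYPE('a::field) n)"
  by (simp add: GL_iff)

lemma mult_GL:
  assumes "A \<in> carrier (GL TYPE('a::field) n)" "B \<in> carrier (GL TYPE('a) n)"
  shows "A * B \<in> carrier (GL TYPE('a) n)"
  using assms by (auto simp: GL_iff det_mult)

lemma GL_inverse:
  assumes "A \<in> carrier (GL TYPE('a::field) n)"
  obtains B where "B \<in> carrier (GL TYPE('a) n)" "A * B = 1\<^sub>m n" "B * A = 1\<^sub>m n"
proof -
  interpret group "GL TYPE('a) n" by (rule group_GL)
  show thesis
    by (rule that[of "inv\<^bsub>GL TYPE('a) n\<^esub> A"])
      (use inv_closed[OF assms] r_inv[OF assms] l_inv[OF assms] in \<open>simp_all add: GL_simps\<close>)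
qed

lemma GL_left_invertible:
  assumes "A \<in> carrier_mat n n" "B \<in> carrier_mat n n" "B * A = 1\<^sub>m n"
  shows "A \<in> carrier (GL TYPE('a::field) n)"
  using assms det_mult[of B n A] by (auto simp: GL_iff)

section \<open>Arithmetic of block matrices\<close>

lemma four_block_GL_iff:
  assumes "A \<in> carrier_mat m m" "B \<in> carrier_mat m n" "D \<in> carrier_mat n n"
  shows "four_block_mat A B (0\<^sub>m n m) D \<in> carrier (GL TYPE('a::field) (m + n)) \<longleftrightarrow>
    A \<in> carrier (GL TYPE('a) m) \<and> D \<in> carrier (GL TYPE('a) n)"
  using assms by (auto simp: GL_iff det_four_block_mat_lower_left_zero)

lemma four_block_GL_lower:
  assumes "A \<in> carrier (GL TYPE('a::field) m)" "C \<in> carrier_mat n m"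
    "D \<in> carrier (GL TYPE('a) n)"
  shows "four_block_mat A (0\<^sub>m m n) C D \<in> carrier (GL TYPE('a) (m + n))"
  using assms by (auto simp: GL_iff det_four_block_mat_upper_right_zero)

lemma mult_four_block_upper:
  fixes A :: "'a::semiring_1 mat"
  assumes "A \<in> carrier_mat a c" "B \<in> carrier_mat a d" "D \<in> carrier_mat b d"
    and "A' \<in> carrier_mat c e" "B' \<in> carrier_mat c f" "D' \<in> carrier_mat d f"
  shows "four_block_mat A B (0\<^sub>m b c) D * four_block_mat A' B' (0\<^sub>m d e) D' =
    four_block_mat (A * A') (A * B' + B * D') (0\<^sub>m b e) (D * D')"
  using assms by (subst mult_four_block_mat) auto

lemma mult_four_block_diag:
  fixes A :: "'a::semiring_1 mat"
  assumes "A \<in> carrier_mat a c" "D \<in> carrier_mat b d"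
    and "A' \<in> carrier_mat c e" "D' \<in> carrier_mat d f"
  shows "four_block_mat A (0\<^sub>m a d) (0\<^sub>m b c) D * four_block_mat A' (0\<^sub>m c f) (0\<^sub>m d e) D' =
    four_block_mat (A * A') (0\<^sub>m a f) (0\<^sub>m b e) (D * D')"
  using assms by (subst mult_four_block_mat) auto

lemma four_block_split:
  assumes "A \<in> carrier_mat (m + n) (p + q)"
  obtains A1 A2 A3 A4 where "A = four_block_mat A1 A2 A3 A4"
    "A1 \<in> carrier_mat m p" "A2 \<in> carrier_mat m q" "A3 \<in> carrier_mat n p" "A4 \<in> carrier_mat n q"
proof -
  obtain A1 A2 A3 A4 where "split_block A m p = (A1, A2, A3, A4)"
    by (cases "split_block A m p") auto
  from split_block[OF this, of n q] assms that show thesis by auto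
qed

lemma four_block_eqD:
  assumes "four_block_mat A B C D = four_block_mat A' B' C' D'"
    and "A \<in> carrier_mat m p" "B \<in> carrier_mat m q" "C \<in> carrier_mat n p" "D \<in> carrier_mat n q"
    and "A' \<in> carrier_mat m p" "B' \<in> carrier_mat m q" "C' \<in> carrier_mat n p" "D' \<in> carrier_mat n q"
  shows "A = A'" "B = B'" "C = C'" "D = D'"
proof -
  have e: "four_block_mat A B C D $$ (i,j) = four_block_mat A' B' C' D' $$ (i,j)" for i j
    using assms(1) by simp
  show "A = A'"
  proof (rule eq_matI)
    fix i j assume "i < dim_row A'" "j < dim_col A'"
    then show "A $$ (i,j) = A' $$ (i,j)" using e[of i j] assms(2-) by auto
  qed (use assms in auto)
  show "B = B'"
  proof (rule eq_matI)
    fix i j assume "i < dim_row B'" "j < dim_col B'"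
    then show "B $$ (i,j) = B' $$ (i,j)" using e[of i "j + p"] assms(2-) by auto
  qed (use assms in auto)
  show "C = C'"
  proof (rule eq_matI)
    fix i j assume "i < dim_row C'" "j < dim_col C'"
    then show "C $$ (i,j) = C' $$ (i,j)" using e[of "i + m" j] assms(2-) by auto
  qed (use assms in auto)
  show "D = D'"
  proof (rule eq_matI)
    fix i j assume "i < dim_row D'" "j < dim_col D'"
    then show "D $$ (i,j) = D' $$ (i,j)" using e[of "i + m" "j + p"] assms(2-) by auto
  qed (use assms in auto)
qed

section \<open>Matrices of unit columns and the rank normal form\<close>

text \<open>Column \<open>j\<close> is the unit vector with index \<open>f j\<close>, or zero if \<open>f j \<ge> m\<close>.\<close>

definition unit_cols :: "nat \<Rightarrow> nat \<Rightarrow> (nat \<Rightarrow> nat) \<Rightarrow> 'a::semiring_1 mat" where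
  "unit_cols m q f = mat m q (\<lambda>(i, j). if i = f j then 1 else 0)"

lemma unit_cols_carrier [simp]: "unit_cols m q f \<in> carrier_mat m q"
  and unit_cols_dim [simp]: "dim_row (unit_cols m q f) = m" "dim_col (unit_cols m q f) = q"
  and unit_cols_index [simp]:
    "i < m \<Longrightarrow> j < q \<Longrightarrow> unit_cols m q f $$ (i, j) = (if i = f j then 1 else 0)"
  by (simp_all add: unit_cols_def)

lemma mult_unit_cols:
  fixes A :: "'a::semiring_1 mat"
  assumes "A \<in> carrier_mat m p"
  shows "A * unit_cols p q f = mat m q (\<lambda>(i, j). if f j < p then A $$ (i, f j) else 0)"
proof (rule eq_matI)
  fix i j
  assume "i < dim_row (mat m q (\<lambda>(i, j). if f j < p then A $$ (i, f j) else 0))"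
    "j < dim_col (mat m q (\<lambda>(i, j). if f j < p then A $$ (i, f j) else 0))"
  then have ij: "i < m" "j < q" by auto
  have "(A * unit_cols p q f) $$ (i, j) = (\<Sum>x = 0..<p. A $$ (i, x) * (if x = f j then 1 else 0))"
    using ij assms by (auto simp: scalar_prod_def intro!: sum.cong)
  also have "\<dots> = (\<Sum>x = 0..<p. if x = f j then A $$ (i, x) else 0)"
    by (rule sum.cong) auto
  also have "\<dots> = (if f j < p then A $$ (i, f j) else 0)" by simp
  finally show "(A * unit_cols p q f) $$ (i, j)
      = mat m q (\<lambda>(i, j). if f j < p then A $$ (i, f j) else 0) $$ (i, j)"
    using ij by simp
qed (use assms in auto)

text \<open>Products compose the index functions. An out-of-range value of \<open>g\<close> gives a
  zero column, which the product keeps; the second assumption makes \<open>h\<close> mark it as zero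
  too.\<close>

lemma unit_cols_mult:
  assumes "\<And>j. j < q \<Longrightarrow> g j < p \<Longrightarrow> h j = f (g j)" "\<And>j. j < q \<Longrightarrow> p \<le> g j \<Longrightarrow> m \<le> h j"
  shows "unit_cols m p f * unit_cols p q g = (unit_cols m q h :: 'a::semiring_1 mat)"
  unfolding mult_unit_cols[OF unit_cols_carrier]
proof (rule eq_matI)
  fix i j
  assume "i < dim_row (unit_cols m q h :: 'a mat)" "j < dim_col (unit_cols m q h :: 'a mat)"
  then have "i < m" "j < q" by auto
  then show "mat m q (\<lambda>(i, j). if g j < p then unit_cols m p f $$ (i, g j) else 0) $$ (i, j)
      = (unit_cols m q h $$ (i, j) :: 'a)"
    using assms[of j] by (cases "g j < p") auto
qed auto

lemma unit_cols_one: "unit_cols n n (\<lambda>j. j) = 1\<^sub>m n"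
  by (rule eq_matI) auto

text \<open>Gaussian elimination by induction on the number of rows, with \<open>q\<close>
  arbitrary: a nonzero entry is moved to the corner, its row and column are cleared, and the
  induction hypothesis treats the remaining block. The value \<open>m\<close> of the index function
  marks a zero column.\<close>

lemma rank_normal_form:
  fixes A :: "'a::field mat"
  assumes "A \<in> carrier_mat m q"
  shows "\<exists>g \<in> carrier (GL TYPE('a) m). \<exists>h \<in> carrier (GL TYPE('a) q). \<exists>t \<le> min m q.
    g * A * h = unit_cols m q (\<lambda>j. if j < t then j else m)"
  using assms
proof (induction m arbitrary: A q)
  case 0
  then have "1\<^sub>m 0 * A * 1\<^sub>m q = unit_cols 0 q (\<lambda>j. if j < 0 then j else 0)"
    by (auto intro!: eq_matI)
  then show ?case by (intro bexI[OF _ one_GL] exI[of _ 0]) auto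
next
  case (Suc m)
  show ?case
  proof (cases "A = 0\<^sub>m (Suc m) q")
    case True
    then have "1\<^sub>m (Suc m) * A * 1\<^sub>m q = unit_cols (Suc m) q (\<lambda>j. if j < 0 then j else Suc m)"
      by (auto intro!: eq_matI)
    then show ?thesis by (intro bexI[OF _ one_GL] exI[of _ 0]) auto
  next
    case False
    then obtain i j where ij: "i < Suc m" "j < q" "A $$ (i, j) \<noteq> 0"
      using Suc.prems by (metis carrier_matD eq_matI index_zero_mat)
    then obtain p where q: "q = Suc p" by (cases q) auto
    \<comment> \<open>Transpositions of rows \<open>0\<close>, \<open>i\<close> and of columns
      \<open>0\<close>, \<open>j\<close> bring the nonzero entry to the corner.\<close>
    define P Q where "P = (swaprows_mat (Suc m) 0 i :: 'a mat)"
      and "Q = (swaprows_mat q 0 j :: 'a mat)"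
    have PQ: "P \<in> carrier (GL TYPE('a) (Suc m))" "Q \<in> carrier (GL TYPE('a) q)"
      using swaprows_mat_Unit[of 0 "Suc m" i] swaprows_mat_Unit[of 0 q j] ij
      by (auto simp: P_def Q_def GL_def units_of_carrier)
    note PQc = PQ[THEN GL_carrier]
    have "P * A \<in> carrier_mat (Suc m) q" using PQc Suc.prems by simp
    then have "P * A * Q = swapcols 0 j (P * A)"
      unfolding Q_def using ij by (intro swapcols_mat[symmetric]) auto
    moreover have "P * A = swaprows 0 i A"
      unfolding P_def using ij Suc.prems by (intro swaprows_mat[symmetric]) auto
    ultimately have "P * A * Q = swapcols 0 j (swaprows 0 i A)" by simp
    then have c: "(P * A * Q) $$ (0, 0) \<noteq> 0"
      using ij Suc.prems by auto
    have "P * A * Q \<in> carrier_mat (1 + m) (1 + p)" using PQc Suc.prems q by auto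
    then obtain a u v Z where B: "P * A * Q = four_block_mat a u v Z"
      and abl: "a \<in> carrier_mat 1 1" "u \<in> carrier_mat 1 p" "v \<in> carrier_mat m 1" "Z \<in> carrier_mat m p"
      by (rule four_block_split)
    have a0: "a $$ (0, 0) \<noteq> 0" using c abl unfolding B by auto
    have "det a \<noteq> 0" using abl a0 by (simp add: det_single)
    then have "a \<in> carrier (GL TYPE('a) 1)" using abl by (simp add: GL_iff)
    then obtain a' where a': "a' \<in> carrier (GL TYPE('a) 1)" "a' * a = 1\<^sub>m 1"
      by (rule GL_inverse)
    note a'c = a'(1)[THEN GL_carrier]
    \<comment> \<open>\<open>L\<close> scales the pivot to 1 and clears the column below it,
      \<open>R\<close> clears the rest of its row. What remains is the Schur complement
      \<open>Z'\<close> of the pivot.\<close>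
    define L R where "L = four_block_mat a' (0\<^sub>m 1 m) (- (v * a')) (1\<^sub>m m)"
      and "R = four_block_mat (1\<^sub>m 1) (- (a' * u)) (0\<^sub>m p 1) (1\<^sub>m p)"
    define Z' where "Z' = - (v * a') * u + Z"
    have Z': "Z' \<in> carrier_mat m p" using abl a'c by (auto simp: Z'_def)
    have L: "L \<in> carrier (GL TYPE('a) (1 + m))"
      unfolding L_def using abl a'(1) a'c by (intro four_block_GL_lower one_GL) auto
    have R: "R \<in> carrier (GL TYPE('a) (1 + p))"
      unfolding R_def using abl a'c
      by (intro iffD2[OF four_block_GL_iff] conjI one_GL) auto
    have 1: "- (v * a') * a + v = 0\<^sub>m m 1"
    proof -
      have "v * a' * a = v * (a' * a)" using abl a'c by (intro assoc_mult_mat)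
      then show ?thesis using abl a'c a' by simp
    qed
    have LB: "L * four_block_mat a u v Z = four_block_mat (1\<^sub>m 1) (a' * u) (0\<^sub>m m 1) Z'"
      unfolding L_def using abl a'c a' 1 
      by (subst mult_four_block_mat[of _ 1 1 _ m _ m _ _ 1 _ p]) (auto simp: Z'_def)
    have LBR: "four_block_mat (1\<^sub>m 1) (a' * u) (0\<^sub>m m 1) Z' * R = four_block_mat (1\<^sub>m 1) (0\<^sub>m 1 p) (0\<^sub>m m 1) Z'"
      unfolding R_def using abl a'c Z' 
      by (subst mult_four_block_upper[of _ 1 1 _ p _ m _ 1]) auto
    from Suc.IH[OF Z'] obtain g h t where gh: "g \<in> carrier (GL TYPE('a) m)" "h \<in> carrier (GL TYPE('a) p)"
      "t \<le> min m p" "g * Z' * h = unit_cols m p (\<lambda>j. if j < t then j else m)" by blast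
    note ghc = gh(1,2)[THEN GL_carrier]
    define G H where "G = four_block_mat (1\<^sub>m 1) (0\<^sub>m 1 m) (0\<^sub>m m 1) g"
      and "H = four_block_mat (1\<^sub>m 1) (0\<^sub>m 1 p) (0\<^sub>m p 1) h"
    have G: "G \<in> carrier (GL TYPE('a) (1 + m))" and H: "H \<in> carrier (GL TYPE('a) (1 + p))"
      unfolding G_def H_def using gh ghc
      by (subst four_block_GL_iff; simp add: one_GL)+
    note LRGHc = L[THEN GL_carrier] R[THEN GL_carrier] G[THEN GL_carrier] H[THEN GL_carrier]
    have GZ: "G * four_block_mat (1\<^sub>m 1) (0\<^sub>m 1 p) (0\<^sub>m m 1) Z'
        = four_block_mat (1\<^sub>m 1) (0\<^sub>m 1 p) (0\<^sub>m m 1) (g * Z')"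
      unfolding G_def using ghc Z' by (subst mult_four_block_diag[of _ 1 1 _ m m _ 1 _ p]) auto
    have GZH: "four_block_mat (1\<^sub>m 1) (0\<^sub>m 1 p) (0\<^sub>m m 1) (g * Z') * H
        = four_block_mat (1\<^sub>m 1) (0\<^sub>m 1 p) (0\<^sub>m m 1) (g * Z' * h)"
      unfolding H_def using ghc Z' by (subst mult_four_block_diag[of _ 1 1 _ m p _ 1 _ p]) auto
    have "G * L * P * A * (Q * R * H) = G * (L * (P * A * Q) * R) * H"
      using LRGHc PQc Suc.prems q 
      by (simp add: assoc_mult_mat[where n\<^sub>1 = "Suc m" and n\<^sub>2 = "Suc m" and n\<^sub>3 = "Suc m" and n\<^sub>4 = "Suc p"]
        assoc_mult_mat[where n\<^sub>1 = "Suc m" and n\<^sub>2 = "Suc m" and n\<^sub>3 = "Suc p" and n\<^sub>4 = "Suc p"]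
        assoc_mult_mat[where n\<^sub>1 = "Suc m" and n\<^sub>2 = "Suc p" and n\<^sub>3 = "Suc p" and n\<^sub>4 = "Suc p"])
    also have "\<dots> = G * four_block_mat (1\<^sub>m 1) (0\<^sub>m 1 p) (0\<^sub>m m 1) Z' * H"
      unfolding B LB LBR ..
    also have "\<dots> = four_block_mat (1\<^sub>m 1) (0\<^sub>m 1 p) (0\<^sub>m m 1) (g * Z' * h)"
      unfolding GZ GZH ..
    \<comment> \<open>The pivot adds one unit column in front, which shifts \<open>t\<close> to
      \<open>Suc t\<close> and the marker of zero columns to \<open>Suc m\<close>.\<close>
    also have "\<dots> = unit_cols (Suc m) q (\<lambda>j. if j < Suc t then j else Suc m)"
      unfolding gh(4) q
    proof (rule eq_matI)
      fix i j assume "i < dim_row (unit_cols (Suc m) (Suc p) (\<lambda>j. if j < Suc t then j else Suc m) :: 'a mat)"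
        "j < dim_col (unit_cols (Suc m) (Suc p) (\<lambda>j. if j < Suc t then j else Suc m) :: 'a mat)"
      then show "four_block_mat (1\<^sub>m 1) (0\<^sub>m 1 p) (0\<^sub>m m 1)
          (unit_cols m p (\<lambda>j. if j < t then j else m)) $$ (i, j)
        = (unit_cols (Suc m) (Suc p) (\<lambda>j. if j < Suc t then j else Suc m) $$ (i, j) :: 'a)"
        by (cases i; cases j) simp_all
    qed simp_all
    finally have "G * L * P * A * (Q * R * H) = \<dots>" .
    moreover have "G * L * P \<in> carrier (GL TYPE('a) (Suc m))" "Q * R * H \<in> carrier (GL TYPE('a) q)"
      using G L R H PQ q by (auto intro!: mult_GL)
    moreover have "Suc t \<le> min (Suc m) q" using gh q by simp
    ultimately show ?thesis by blast
  qed
qed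

section \<open>Matrices with a left inverse, as bases of subspaces\<close>

text \<open>Over a field this means that the columns are linearly independent. In the form of an
  equation it passes directly through products and blocks.\<close>

definition left_invertible :: "'a::semiring_1 mat \<Rightarrow> bool" where
  "left_invertible A \<longleftrightarrow> (\<exists>L \<in> carrier_mat (dim_col A) (dim_row A). L * A = 1\<^sub>m (dim_col A))"

lemma left_invertible_iff:
  "A \<in> carrier_mat m q \<Longrightarrow> left_invertible A \<longleftrightarrow> (\<exists>L \<in> carrier_mat q m. L * A = 1\<^sub>m q)"
  by (auto simp: left_invertible_def)

lemma left_invertible_mult:
  fixes A :: "'a::semiring_1 mat"
  assumes A: "A \<in> carrier_mat m p" and B: "B \<in> carrier_mat p q"
    and "left_invertible A" "left_invertible B"
  shows "left_invertible (A * B)"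
proof -
  obtain L where L: "L \<in> carrier_mat p m" "L * A = 1\<^sub>m p"
    using assms(3) left_invertible_iff[OF A] by blast
  obtain M where M: "M \<in> carrier_mat q p" "M * B = 1\<^sub>m q"
    using assms(4) left_invertible_iff[OF B] by blast
  have "M * L * (A * B) = M * (L * (A * B))"
    by (rule assoc_mult_mat[OF M(1) L(1) mult_carrier_mat[OF A B]])
  also have "L * (A * B) = L * A * B"
    by (rule assoc_mult_mat[OF L(1) A B, symmetric])
  also have "\<dots> = B" unfolding L(2) by (rule left_mult_one_mat[OF B])
  finally have "M * L * (A * B) = 1\<^sub>m q" unfolding M(2) .
  then show ?thesis
    unfolding left_invertible_iff[OF mult_carrier_mat[OF A B]]
    using mult_carrier_mat[OF M(1) L(1)] by blast
qed

lemma GL_imp_left_invertible: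
  assumes "A \<in> carrier (GL TYPE('a::field) n)"
  shows "left_invertible A"
proof -
  from assms obtain B where "B \<in> carrier (GL TYPE('a) n)" "B * A = 1\<^sub>m n"
    by (rule GL_inverse)
  then show ?thesis using assms by (auto simp: left_invertible_def GL_iff)
qed

lemma left_invertible_col_nonzero:
  fixes A :: "'a::field mat"
  assumes "left_invertible A" "j < dim_col A"
  shows "\<exists>i < dim_row A. A $$ (i, j) \<noteq> 0"
proof (rule ccontr)
  assume *: "\<not> ?thesis"
  obtain L where L: "L \<in> carrier_mat (dim_col A) (dim_row A)" "L * A = 1\<^sub>m (dim_col A)"
    using assms by (auto simp: left_invertible_def)
  have "(L * A) $$ (j, j) = row L j \<bullet> col A j" using L(1) assms by simp
  also have "\<dots> = 0" using * assms(2) by (simp add: scalar_prod_def)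
  finally have "(L * A) $$ (j, j) = 0" .
  then show False using L assms by simp
qed

text \<open>The product appends \<open>m\<close> zero rows to \<open>A\<close>. The right-hand
  blocks of width 0 put it in a form to which the block rules apply.\<close>

lemma unit_cols_mult_first:
  fixes A :: "'a::semiring_1 mat"
  assumes "A \<in> carrier_mat k q"
  shows "unit_cols (k + m) k (\<lambda>j. j) * A = four_block_mat A (0\<^sub>m k 0) (0\<^sub>m m q) (0\<^sub>m m 0)"
proof -
  have "unit_cols (k + m) k (\<lambda>j. j) = four_block_mat (1\<^sub>m k) (0\<^sub>m k 0) (0\<^sub>m m k) (0\<^sub>m m 0 :: 'a mat)"
    by (rule eq_matI) auto
  moreover have "A = four_block_mat A (0\<^sub>m k 0) (0\<^sub>m 0 q) (0\<^sub>m 0 0)"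
    using assms by (intro eq_matI) auto
  ultimately have "unit_cols (k + m) k (\<lambda>j. j) * A
    = four_block_mat (1\<^sub>m k) (0\<^sub>m k 0) (0\<^sub>m m k) (0\<^sub>m m 0) * four_block_mat A (0\<^sub>m k 0) (0\<^sub>m 0 q) (0\<^sub>m 0 0)"
    by simp
  also have "\<dots> = four_block_mat A (0\<^sub>m k 0) (0\<^sub>m m q) (0\<^sub>m m 0)"
    using assms by (subst mult_four_block_upper[of _ k k _ 0 _ m]) auto
  finally show ?thesis .
qed

text \<open>A block upper triangular matrix preserves the span of the first \<open>k\<close> unit
  vectors and acts on it by \<open>A\<close>. For \<open>k = r\<close> this is why right
  multiplication by the parabolic subgroup only changes the basis formed by the first
  \<open>r\<close> columns.\<close>

lemma four_block_mult_unit_cols_first: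
  fixes A :: "'a::semiring_1 mat"
  assumes "A \<in> carrier_mat k k" "B \<in> carrier_mat k m" "D \<in> carrier_mat m m"
  shows "four_block_mat A B (0\<^sub>m m k) D * unit_cols (k + m) k (\<lambda>j. j)
    = unit_cols (k + m) k (\<lambda>j. j) * A"
proof -
  have "four_block_mat A B (0\<^sub>m m k) D \<in> carrier_mat (k + m) (k + m)" using assms by simp
  from mult_unit_cols[OF this] show ?thesis
    unfolding unit_cols_mult_first[OF assms(1)] using assms by (intro eq_matI) auto
qed

text \<open>Left invertibility survives multiplication by invertible matrices, so the rank normal
  form has no zero column and \<open>t = q\<close>. The column operation \<open>h\<close> can then
  be traded for a row operation.\<close>

lemma left_invertible_normal_form:
  fixes A :: "'a::field mat"
  assumes A: "A \<in> carrier_mat m q" and inv: "left_invertible A"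
  shows "q \<le> m" "\<exists>g \<in> carrier (GL TYPE('a) m). g * A = unit_cols m q (\<lambda>j. j)"
proof -
  from rank_normal_form[OF A] obtain g h t where gh: "g \<in> carrier (GL TYPE('a) m)"
    "h \<in> carrier (GL TYPE('a) q)" "t \<le> min m q"
    "g * A * h = unit_cols m q (\<lambda>j. if j < t then j else m)" by blast
  note ghc = gh(1,2)[THEN GL_carrier]
  have "left_invertible (g * A * h)"
    by (rule left_invertible_mult[OF mult_carrier_mat[OF ghc(1) A] ghc(2)
          left_invertible_mult[OF ghc(1) A GL_imp_left_invertible[OF gh(1)] inv]
          GL_imp_left_invertible[OF gh(2)]])
  from left_invertible_col_nonzero[OF this, of t] gh A
  have "\<not> t < q" by (auto split: if_splits)
  then have t: "t = q" using gh by simp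
  then show qm: "q \<le> m" using gh by simp
  define p where "p = m - q"
  have m: "m = q + p" using qm p_def by simp
  obtain h' where h': "h' \<in> carrier (GL TYPE('a) q)" "h * h' = 1\<^sub>m q" "h' * h = 1\<^sub>m q"
    using gh(2) by (rule GL_inverse)
  note h'c = h'(1)[THEN GL_carrier]
  \<comment> \<open>Extending \<open>h\<close> by an identity block gives
    \<open>d * ?E = ?E * h\<close>, so \<open>d\<close> cancels the factor \<open>h'\<close> on the
    right of \<open>g * A = ?E * h'\<close>.\<close>
  define d where "d = four_block_mat h (0\<^sub>m q p) (0\<^sub>m p q) (1\<^sub>m p)"
  have d: "d \<in> carrier (GL TYPE('a) m)"
    unfolding d_def m using gh ghc one_GL by (auto simp: four_block_GL_iff)
  note dc = d[THEN GL_carrier]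
  let ?E = "unit_cols m q (\<lambda>j. j) :: 'a mat"
  have E: "?E \<in> carrier_mat m q" by simp
  have gA: "g * A \<in> carrier_mat m q" using ghc A by simp
  have "unit_cols m q (\<lambda>j. if j < t then j else m) = ?E"
    unfolding t by (rule eq_matI) auto
  then have gAh: "g * A * h = ?E" using gh(4) by simp
  have "g * A = g * A * (h * h')" unfolding h'(2) by (rule right_mult_one_mat[OF gA, symmetric])
  also have "\<dots> = ?E * h'" unfolding gAh[symmetric] by (rule assoc_mult_mat[OF gA ghc(2) h'c, symmetric])
  finally have "d * g * A = d * (?E * h')" using assoc_mult_mat[OF dc ghc(1) A] by simp
  also have "\<dots> = d * ?E * h'" by (rule assoc_mult_mat[OF dc E h'c, symmetric])
  also have "d * ?E = ?E * h"
    unfolding d_def m using ghc by (intro four_block_mult_unit_cols_first) auto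
  also have "?E * h * h' = ?E * (h * h')" by (rule assoc_mult_mat[OF E ghc(2) h'c])
  also have "\<dots> = ?E" unfolding h'(2) by (rule right_mult_one_mat[OF E])
  finally have "d * g * A = ?E" .
  with d gh show "\<exists>g \<in> carrier (GL TYPE('a) m). g * A = unit_cols m q (\<lambda>j. j)"
    by (blast intro: mult_GL)
qed

text \<open>The first \<open>k\<close> columns of \<open>h\<close> span the kernel of
  \<open>A\<close>, and \<open>B\<close> is a basis of its image. Both are read off from the rank
  normal form after undoing the row operation.\<close>

lemma column_reduction:
  fixes A :: "'a::field mat"
  assumes A: "A \<in> carrier_mat m q"
  shows "\<exists>h \<in> carrier (GL TYPE('a) q). \<exists>k. \<exists>B \<in> carrier_mat m (q - k). k \<le> q \<and>
    left_invertible B \<and> A * h = four_block_mat (0\<^sub>m m k) B (0\<^sub>m 0 k) (0\<^sub>m 0 (q - k))"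
proof -
  from rank_normal_form[OF A] obtain g h t where gh: "g \<in> carrier (GL TYPE('a) m)"
    "h \<in> carrier (GL TYPE('a) q)" "t \<le> min m q"
    "g * A * h = unit_cols m q (\<lambda>j. if j < t then j else m)" by blast
  note ghc = gh(1,2)[THEN GL_carrier]
  obtain g' where g': "g' \<in> carrier (GL TYPE('a) m)" "g * g' = 1\<^sub>m m" "g' * g = 1\<^sub>m m"
    using gh(1) by (rule GL_inverse)
  note g'c = g'(1)[THEN GL_carrier]
  define k where "k = q - t"
  have k: "k \<le> q" "q - k = t" using gh by (auto simp: k_def)
  \<comment> \<open>The normal form has its zero columns last; \<open>s\<close> permutes the columns
    cyclically so that these \<open>k\<close> columns come first.\<close>
  define s where "s = (unit_cols q q (\<lambda>j. if j < k then j + t else j - k) :: 'a mat)"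
  have "unit_cols q q (\<lambda>j. if j < t then j + k else j - t) * s = 1\<^sub>m q"
    unfolding s_def unit_cols_one[symmetric] using k by (intro unit_cols_mult) (auto split: if_splits)
  then have s: "s \<in> carrier (GL TYPE('a) q)"
    by (intro GL_left_invertible[of s q "unit_cols q q (\<lambda>j. if j < t then j + k else j - t)"])
      (auto simp: s_def)
  have sc: "s \<in> carrier_mat q q" by (simp add: s_def)
  define B where "B = g' * unit_cols m t (\<lambda>j. j)"
  have B: "B \<in> carrier_mat m t" using g'c by (simp add: B_def)
  have "unit_cols t m (\<lambda>j. j) * (unit_cols m t (\<lambda>j. j) :: 'a mat) = 1\<^sub>m t"
    unfolding unit_cols_one[symmetric] using gh by (intro unit_cols_mult) auto
  then have "left_invertible (unit_cols m t (\<lambda>j. j) :: 'a mat)"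
    unfolding left_invertible_def by (intro bexI[of _ "unit_cols t m (\<lambda>j. j)"]) auto
  then have "left_invertible B"
    unfolding B_def
    by (rule left_invertible_mult[OF g'c unit_cols_carrier GL_imp_left_invertible[OF g'(1)]])
  moreover have "A * (h * s) = four_block_mat (0\<^sub>m m k) B (0\<^sub>m 0 k) (0\<^sub>m 0 (q - k))"
  proof -
    have "A * (h * s) = g' * (g * A * h) * s"
    proof -
      have "g' * (g * A * h) * s = g' * g * (A * (h * s))"
        using g'c ghc A sc by (simp add: assoc_mult_mat[of _ m m _ m _ q] assoc_mult_mat[of _ m m _ q _ q] assoc_mult_mat[of _ m q _ q _ q])
      then show ?thesis using g' A ghc sc by (simp)
    qed
    also have "\<dots> = g' * (unit_cols m q (\<lambda>j. if j < t then j else m) * s)"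
      unfolding gh(4) using g'c sc by (simp add: assoc_mult_mat[of _ m m _ q _ q])
    also have "unit_cols m q (\<lambda>j. if j < t then j else m) * s
        = unit_cols m q (\<lambda>j. if j < k then m else j - k)"
      unfolding s_def using gh(3) k by (intro unit_cols_mult) auto
    also have "g' * \<dots> = four_block_mat (0\<^sub>m m k) B (0\<^sub>m 0 k) (0\<^sub>m 0 (q - k))"
      unfolding B_def mult_unit_cols[OF g'c] using k gh(3)
      by (intro eq_matI) (auto simp: min_def split: if_splits)
    finally show ?thesis .
  qed
  ultimately show ?thesis using k B
    by (intro bexI[OF _ mult_GL[OF gh(2) s]] exI[of _ k] bexI[of _ B] conjI) auto
qed

text \<open>For a subspace with basis \<open>M\<close>, \<open>X1\<close> is a basis of its
  intersection with the first summand and \<open>Y\<close> a basis of its projection to the second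
  one. The matrix \<open>h\<close> comes from column reduction of the lower half of
  \<open>M\<close>, whose kernel describes that intersection.\<close>

lemma split_left_invertible:
  fixes M :: "'a::field mat"
  assumes M: "M \<in> carrier_mat (m + n) q" and inv: "left_invertible M"
  obtains h k X1 X2 Y where "h \<in> carrier (GL TYPE('a) q)" "k \<le> q"
    "X1 \<in> carrier_mat m k" "X2 \<in> carrier_mat m (q - k)" "Y \<in> carrier_mat n (q - k)"
    "left_invertible X1" "left_invertible Y" "M * h = four_block_mat X1 X2 (0\<^sub>m n k) Y"
proof -
  \<comment> \<open>A second block column of width 0 makes the block splitting cut \<open>M\<close>
    into its upper and lower halves.\<close>
  have "M \<in> carrier_mat (m + n) (q + 0)" using M by simp
  then obtain M1 Z1 M2 Z2 where Mb: "M = four_block_mat M1 Z1 M2 Z2"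
    "M1 \<in> carrier_mat m q" "Z1 \<in> carrier_mat m 0" "M2 \<in> carrier_mat n q" "Z2 \<in> carrier_mat n 0"
    by (rule four_block_split)
  from column_reduction[OF Mb(4)] obtain h k Y where h: "h \<in> carrier (GL TYPE('a) q)" "k \<le> q"
    "Y \<in> carrier_mat n (q - k)" "left_invertible Y"
    "M2 * h = four_block_mat (0\<^sub>m n k) Y (0\<^sub>m 0 k) (0\<^sub>m 0 (q - k))" by blast
  note hc = h(1)[THEN GL_carrier]
  have "M * h \<in> carrier_mat (m + n) (k + (q - k))" using M hc h(2) by simp
  then obtain X1 X2 Y1 Y2 where Mh: "M * h = four_block_mat X1 X2 Y1 Y2"
    "X1 \<in> carrier_mat m k" "X2 \<in> carrier_mat m (q - k)"
    "Y1 \<in> carrier_mat n k" "Y2 \<in> carrier_mat n (q - k)"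
    by (rule four_block_split)
  have "h = four_block_mat h (0\<^sub>m q 0) (0\<^sub>m 0 q) (0\<^sub>m 0 0)"
    using hc by (intro eq_matI) auto
  then have "M * h = four_block_mat M1 Z1 M2 Z2 * four_block_mat h (0\<^sub>m q 0) (0\<^sub>m 0 q) (0\<^sub>m 0 0)"
    using Mb(1) by simp
  also have "\<dots> = four_block_mat (M1 * h) (0\<^sub>m m 0) (M2 * h) (0\<^sub>m n 0)"
    using Mb hc by (subst mult_four_block_mat[of _ m q _ 0 _ n _ _ q _ 0]) auto
  finally have e: "four_block_mat X1 X2 Y1 Y2 = four_block_mat (M1 * h) (0\<^sub>m m 0) (M2 * h) (0\<^sub>m n 0)"
    using Mh(1) by simp
  have low: "four_block_mat X1 X2 Y1 Y2 $$ (m + i, j) = (M2 * h) $$ (i, j)" if "i < n" "j < q" for i j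
    unfolding e using that Mb hc by auto
  have "Y1 = 0\<^sub>m n k"
  proof (rule eq_matI)
    fix i j assume ij: "i < dim_row (0\<^sub>m n k)" "j < dim_col (0\<^sub>m n k)"
    then show "Y1 $$ (i, j) = 0\<^sub>m n k $$ (i, j)"
      using low[of i j] Mh(2-) h(2,3) unfolding h(5) by auto
  qed (use Mh in auto)
  moreover have "Y2 = Y"
  proof (rule eq_matI)
    fix i j assume ij: "i < dim_row Y" "j < dim_col Y"
    then show "Y2 $$ (i, j) = Y $$ (i, j)"
      using low[of i "j + k"] Mh(2-) h(2,3) unfolding h(5) by auto
  qed (use Mh h in auto)
  ultimately have Mh': "M * h = four_block_mat X1 X2 (0\<^sub>m n k) Y" using Mh(1) by simp
  have "left_invertible (M * h)"
    by (rule left_invertible_mult[OF M hc inv GL_imp_left_invertible[OF h(1)]])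
  then obtain L where L: "L \<in> carrier_mat (k + (q - k)) (m + n)" "L * (M * h) = 1\<^sub>m (k + (q - k))"
    using M hc h(2) by (auto simp: left_invertible_def)
  \<comment> \<open>As the first \<open>k\<close> columns of \<open>M * h\<close> vanish in the
    lower half, the corner \<open>L1\<close> alone is a left inverse of \<open>X1\<close>.\<close>
  from L(1) obtain L1 L2 L3 L4 where Lb: "L = four_block_mat L1 L2 L3 L4"
    "L1 \<in> carrier_mat k m" "L2 \<in> carrier_mat k n" "L3 \<in> carrier_mat (q - k) m" "L4 \<in> carrier_mat (q - k) n"
    by (rule four_block_split)
  have "four_block_mat (L1 * X1) (L1 * X2 + L2 * Y) (L3 * X1) (L3 * X2 + L4 * Y)
      = four_block_mat (1\<^sub>m k) (0\<^sub>m k (q - k)) (0\<^sub>m (q - k) k) (1\<^sub>m (q - k))"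
    using L(2) unfolding Mh' Lb(1) using Lb(2-) Mh(2-) h(3)
    by (subst (asm) mult_four_block_mat[of _ k m _ n _ "q - k" _ _ k _ "q - k"]) auto
  from four_block_eqD(1)[OF this, of k k "q - k" "q - k"] Lb(2-) Mh(2-) h(3)
  have "L1 * X1 = 1\<^sub>m k" by auto
  then have "left_invertible X1"
    unfolding left_invertible_def using Lb Mh by (intro bexI[of _ L1]) auto
  with that[OF h(1,2) Mh(2,3) h(3) _ h(4) Mh'] show thesis by simp
qed

text \<open>Preserving the span of the first \<open>k\<close> unit vectors forces the lower left
  block to vanish. This is how elements of the parabolic subgroup are recognized.\<close>

lemma four_block_of_mult_unit_cols_first:
  fixes P :: "'a::semiring_1 mat"
  assumes P: "P \<in> carrier_mat (k + m) (k + m)" and A: "A \<in> carrier_mat k k"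
    and eq: "P * unit_cols (k + m) k (\<lambda>j. j) = unit_cols (k + m) k (\<lambda>j. j) * A"
  shows "\<exists>B \<in> carrier_mat k m. \<exists>D \<in> carrier_mat m m. P = four_block_mat A B (0\<^sub>m m k) D"
proof -
  from P obtain P1 P2 P3 P4 where Pb: "P = four_block_mat P1 P2 P3 P4"
    "P1 \<in> carrier_mat k k" "P2 \<in> carrier_mat k m" "P3 \<in> carrier_mat m k" "P4 \<in> carrier_mat m m"
    by (rule four_block_split)
  have "P * unit_cols (k + m) k (\<lambda>j. j) = four_block_mat P1 (0\<^sub>m k 0) P3 (0\<^sub>m m 0)"
    unfolding mult_unit_cols[OF P] unfolding Pb(1) using Pb(2-) by (intro eq_matI) auto
  with eq have "four_block_mat P1 (0\<^sub>m k 0) P3 (0\<^sub>m m 0) = four_block_mat A (0\<^sub>m k 0) (0\<^sub>m m k) (0\<^sub>m m 0)"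
    unfolding unit_cols_mult_first[OF A] by simp
  from four_block_eqD(1,3)[where q = 0, OF this Pb(2) _ Pb(4) _ A] have "P1 = A" "P3 = 0\<^sub>m m k" by auto
  with Pb show ?thesis by blast
qed

lemma add_uminus_mat:
  "A \<in> carrier_mat m n \<Longrightarrow> A + - A = (0\<^sub>m m n :: 'a::group_add mat)"
  by (rule eq_matI) auto

text \<open>Here the first summand, of dimension \<open>k\<close>, is the subspace A in standard
  position, and \<open>Y\<close> is a basis of the other subspace. Splitting \<open>Y\<close> along
  it yields bases of the intersection and of the image in the quotient; \<open>a\<close> and
  \<open>d\<close> normalize these, and \<open>b\<close> removes the mixed block. The bounds on
  \<open>l\<close> are the dimension bounds of the two pieces.\<close>

lemma left_invertible_pair_normal_form:
  fixes Y :: "'a::field mat"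
  assumes Y: "Y \<in> carrier_mat (k + m) p" and inv: "left_invertible Y"
  obtains a b d h l where "a \<in> carrier (GL TYPE('a) k)" "b \<in> carrier_mat k m"
    "d \<in> carrier (GL TYPE('a) m)" "h \<in> carrier (GL TYPE('a) p)" "l \<le> p" "l \<le> k" "p - l \<le> m"
    "four_block_mat a b (0\<^sub>m m k) d * Y * h = unit_cols (k + m) p (\<lambda>j. if j < l then j else j - l + k)"
proof -
  from split_left_invertible[OF Y inv] obtain h l A B C where h: "h \<in> carrier (GL TYPE('a) p)"
    and l: "l \<le> p"
    and A: "A \<in> carrier_mat k l" and B: "B \<in> carrier_mat k (p - l)" and C: "C \<in> carrier_mat m (p - l)"
    and invs: "left_invertible A" "left_invertible C"
    and Yh: "Y * h = four_block_mat A B (0\<^sub>m m l) C" .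
  from left_invertible_normal_form[OF A invs(1)] obtain a where lk: "l \<le> k"
    and a: "a \<in> carrier (GL TYPE('a) k)" and aA: "a * A = unit_cols k l (\<lambda>j. j)" by blast
  from left_invertible_normal_form[OF C invs(2)] obtain d where pl: "p - l \<le> m"
    and d: "d \<in> carrier (GL TYPE('a) m)" and dC: "d * C = unit_cols m (p - l) (\<lambda>j. j)" by blast
  obtain L where L: "L \<in> carrier_mat (p - l) m" and LC: "L * C = 1\<^sub>m (p - l)"
    using invs(2) left_invertible_iff[OF C] by blast
  note ac = a[THEN GL_carrier] and dc = d[THEN GL_carrier] and hc = h[THEN GL_carrier]
  have aB: "a * B \<in> carrier_mat k (p - l)" using ac B by simp
  \<comment> \<open>Since \<open>L * C = 1\<close>, this choice solves
    \<open>a * B + b * C = 0\<close>.\<close>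
  define b where "b = - (a * B * L)"
  have b: "b \<in> carrier_mat k m" using aB L by (simp add: b_def)
  have "a * B * L * C = a * B * (L * C)" by (rule assoc_mult_mat[OF aB L C])
  also have "\<dots> = a * B" unfolding LC by (rule right_mult_one_mat[OF aB])
  finally have bC: "b * C = - (a * B)"
    unfolding b_def using aB L C by (subst uminus_mult_left_mat) auto
  have "four_block_mat a b (0\<^sub>m m k) d * Y * h = four_block_mat a b (0\<^sub>m m k) d * (Y * h)"
    by (rule assoc_mult_mat[OF four_block_carrier_mat[OF ac dc] Y hc])
  also have "\<dots> = four_block_mat (a * A) (a * B + b * C) (0\<^sub>m m l) (d * C)"
    unfolding Yh by (rule mult_four_block_upper[OF ac b dc A B C])
  also have "a * B + b * C = 0\<^sub>m k (p - l)"
    unfolding bC using aB by (simp add: add_uminus_mat)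
  also have "four_block_mat (a * A) (0\<^sub>m k (p - l)) (0\<^sub>m m l) (d * C)
      = unit_cols (k + m) p (\<lambda>j. if j < l then j else j - l + k)"
    unfolding aA dC
  proof (rule eq_matI)
    fix i j assume "i < dim_row (unit_cols (k + m) p (\<lambda>j. if j < l then j else j - l + k) :: 'a mat)"
      "j < dim_col (unit_cols (k + m) p (\<lambda>j. if j < l then j else j - l + k) :: 'a mat)"
    then have ij: "i < k + m" "j < p" by simp_all
    have "i = j - l + k \<longleftrightarrow> i - k = j - l" if "k \<le> i"
      using that by (metis add_diff_cancel_right' le_add_diff_inverse2)
    with ij l lk pl show "four_block_mat (unit_cols k l (\<lambda>j. j)) (0\<^sub>m k (p - l)) (0\<^sub>m m l)
        (unit_cols m (p - l) (\<lambda>j. j)) $$ (i, j)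
      = (unit_cols (k + m) p (\<lambda>j. if j < l then j else j - l + k) $$ (i, j) :: 'a)"
      by (cases "i < k"; cases "j < l") simp_all
  qed (use l in simp_all)
  finally show thesis using that[OF a b d h l lk pl] by simp
qed

section \<open>The parabolic and Shalika subgroups\<close>

lemma subgroup_GLI:
  assumes "H \<subseteq> carrier (GL TYPE('a::field) n)" "1\<^sub>m n \<in> H"
    and "\<And>A B. A \<in> H \<Longrightarrow> B \<in> H \<Longrightarrow> A * B \<in> H" "\<And>A. A \<in> H \<Longrightarrow> \<exists>B \<in> H. B * A = 1\<^sub>m n"
  shows "subgroup H (GL TYPE('a) n)"
proof -
  interpret group "GL TYPE('a) n" by (rule group_GL)
  show ?thesis
  proof (rule subgroupI)
    fix A assume A: "A \<in> H"
    then obtain B where B: "B \<in> H" "B * A = 1\<^sub>m n" using assms(4) by blast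
    then have "inv\<^bsub>GL TYPE('a) n\<^esub> A = B"
      using A assms(1) by (intro inv_equality) (auto simp: GL_simps)
    with B show "inv\<^bsub>GL TYPE('a) n\<^esub> A \<in> H" by simp
  qed (use assms in \<open>auto simp: GL_simps\<close>)
qed

text \<open>The upper right block \<open>X\<close> of the left inverse has to solve
  \<open>A' * B + X * D = 0\<close>. With \<open>D = A\<close> and \<open>D' = A'\<close> the
  inverse again has equal diagonal blocks, as the Shalika group requires.\<close>

lemma four_block_upper_inverse:
  fixes A :: "'a::field mat"
  assumes "A \<in> carrier_mat m m" "B \<in> carrier_mat m n" "D \<in> carrier_mat n n"
    and "A' \<in> carrier_mat m m" "D' \<in> carrier_mat n n" "A' * A = 1\<^sub>m m" "D' * D = 1\<^sub>m n"
  shows "four_block_mat A' (- (A' * B * D')) (0\<^sub>m n m) D' * four_block_mat A B (0\<^sub>m n m) D = 1\<^sub>m (m + n)"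
proof -
  have AB: "A' * B \<in> carrier_mat m n" using assms by simp
  have "A' * B * D' * D = A' * B * (D' * D)"
    by (rule assoc_mult_mat[OF AB assms(5,3)])
  also have "\<dots> = A' * B" unfolding assms(7) by (rule right_mult_one_mat[OF AB])
  finally have "- (A' * B * D') * D = - (A' * B)"
    using AB assms by (subst uminus_mult_left_mat) auto
  then have "A' * B + - (A' * B * D') * D = 0\<^sub>m m n"
    using AB by (simp add: add_uminus_mat)
  moreover have "- (A' * B * D') \<in> carrier_mat m n" using AB assms by simp
  ultimately show ?thesis
    using mult_four_block_upper[OF assms(4) _ assms(5) assms(1,2,3)] assms(6,7) by simp
qed

lemma subgroup_parabolic: "subgroup (parabolic_subgroup TYPE('a::field) r m) (GL TYPE('a) (r + m))"
proof (rule subgroup_GLI)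
  show "parabolic_subgroup TYPE('a) r m \<subseteq> carrier (GL TYPE('a) (r + m))"
    by (auto simp: parabolic_subgroup_def GL_carrier four_block_GL_iff)
  show "1\<^sub>m (r + m) \<in> parabolic_subgroup TYPE('a) r m"
    unfolding parabolic_subgroup_def mem_Collect_eq
    by (intro exI[of _ "1\<^sub>m r"] exI[of _ "0\<^sub>m r m"] exI[of _ "1\<^sub>m m"]) (simp add: one_GL)
next
  fix A B assume "A \<in> parabolic_subgroup TYPE('a) r m" "B \<in> parabolic_subgroup TYPE('a) r m"
  then obtain a x d a' x' d' where *:
    "A = four_block_mat a x (0\<^sub>m m r) d" "B = four_block_mat a' x' (0\<^sub>m m r) d'"
    "a \<in> carrier (GL TYPE('a) r)" "a' \<in> carrier (GL TYPE('a) r)"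
    "d \<in> carrier (GL TYPE('a) m)" "d' \<in> carrier (GL TYPE('a) m)"
    "x \<in> carrier_mat r m" "x' \<in> carrier_mat r m"
    unfolding parabolic_subgroup_def by blast
  note c = *(3-6)[THEN GL_carrier]
  have "A * B = four_block_mat (a * a') (a * x' + x * d') (0\<^sub>m m r) (d * d')"
    unfolding *(1,2) by (rule mult_four_block_upper[OF c(1) *(7) c(3) c(2) *(8) c(4)])
  moreover have "a * x' + x * d' \<in> carrier_mat r m" using c * by simp
  ultimately show "A * B \<in> parabolic_subgroup TYPE('a) r m"
    unfolding parabolic_subgroup_def using * mult_GL by blast
next
  fix A assume "A \<in> parabolic_subgroup TYPE('a) r m"
  then obtain a x d where *: "A = four_block_mat a x (0\<^sub>m m r) d"
    "a \<in> carrier (GL TYPE('a) r)" "d \<in> carrier (GL TYPE('a) m)" "x \<in> carrier_mat r m"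
    unfolding parabolic_subgroup_def by blast
  obtain a' where a': "a' \<in> carrier (GL TYPE('a) r)" "a' * a = 1\<^sub>m r" using *(2) by (rule GL_inverse)
  obtain d' where d': "d' \<in> carrier (GL TYPE('a) m)" "d' * d = 1\<^sub>m m" using *(3) by (rule GL_inverse)
  note c = *(2,3)[THEN GL_carrier] a'(1)[THEN GL_carrier] d'(1)[THEN GL_carrier]
  have "four_block_mat a' (- (a' * x * d')) (0\<^sub>m m r) d' * A = 1\<^sub>m (r + m)"
    unfolding *(1) by (rule four_block_upper_inverse[OF c(1) *(4) c(2,3,4) a'(2) d'(2)])
  moreover have "- (a' * x * d') \<in> carrier_mat r m" using c * by simp
  ultimately show "\<exists>B \<in> parabolic_subgroup TYPE('a) r m. B * A = 1\<^sub>m (r + m)"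
    unfolding parabolic_subgroup_def using a' d' by blast
qed

lemma subgroup_shalika: "subgroup (shalika_subgroup TYPE('a::field) n) (GL TYPE('a) (n + n))"
proof (rule subgroup_GLI)
  show "shalika_subgroup TYPE('a) n \<subseteq> carrier (GL TYPE('a) (n + n))"
    by (auto simp: shalika_subgroup_def GL_carrier four_block_GL_iff)
  show "1\<^sub>m (n + n) \<in> shalika_subgroup TYPE('a) n"
    unfolding shalika_subgroup_def mem_Collect_eq
    by (intro exI[of _ "1\<^sub>m n"] exI[of _ "0\<^sub>m n n"]) (simp add: one_GL)
next
  fix A B assume "A \<in> shalika_subgroup TYPE('a) n" "B \<in> shalika_subgroup TYPE('a) n"
  then obtain a x a' x' where *:
    "A = four_block_mat a x (0\<^sub>m n n) a" "B = four_block_mat a' x' (0\<^sub>m n n) a'"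
    "a \<in> carrier (GL TYPE('a) n)" "a' \<in> carrier (GL TYPE('a) n)"
    "x \<in> carrier_mat n n" "x' \<in> carrier_mat n n"
    unfolding shalika_subgroup_def by blast
  note c = *(3,4)[THEN GL_carrier]
  have "A * B = four_block_mat (a * a') (a * x' + x * a') (0\<^sub>m n n) (a * a')"
    unfolding *(1,2) by (rule mult_four_block_upper[OF c(1) *(5) c(1) c(2) *(6) c(2)])
  moreover have "a * x' + x * a' \<in> carrier_mat n n" using c * by simp
  ultimately show "A * B \<in> shalika_subgroup TYPE('a) n"
    unfolding shalika_subgroup_def using * mult_GL by blast
next
  fix A assume "A \<in> shalika_subgroup TYPE('a) n"
  then obtain a x where *: "A = four_block_mat a x (0\<^sub>m n n) a"
    "a \<in> carrier (GL TYPE('a) n)" "x \<in> carrier_mat n n"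
    unfolding shalika_subgroup_def by blast
  obtain a' where a': "a' \<in> carrier (GL TYPE('a) n)" "a' * a = 1\<^sub>m n" using *(2) by (rule GL_inverse)
  note c = *(2)[THEN GL_carrier] a'(1)[THEN GL_carrier]
  have "four_block_mat a' (- (a' * x * a')) (0\<^sub>m n n) a' * A = 1\<^sub>m (n + n)"
    unfolding *(1) by (rule four_block_upper_inverse[OF c(1) *(3) c(1) c(2) c(2) a'(2) a'(2)])
  moreover have "- (a' * x * a') \<in> carrier_mat n n" using c * by simp
  ultimately show "\<exists>B \<in> shalika_subgroup TYPE('a) n. B * A = 1\<^sub>m (n + n)"
    unfolding shalika_subgroup_def using a' by blast
qed

section \<open>The representatives as permutation matrices\<close>

text \<open>This is the row of the entry 1 in column \<open>j\<close> of the representative. The six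
  branches are its block columns; the last block starts at r + n - l in rows and columns alike, so
  it is fixed. In the admissible range no subtraction truncates.\<close>

definition w_perm :: "nat \<Rightarrow> nat \<Rightarrow> nat \<Rightarrow> nat \<Rightarrow> nat \<Rightarrow> nat" where
  "w_perm n r k l j =
    (if j < k then j else if j < k + l then j - k + n else if j < r then j - l + n
     else if j < r + n - k then j - r + k else if j < r + n - l then j + k + l - r else j)"

definition w_perm_inv :: "nat \<Rightarrow> nat \<Rightarrow> nat \<Rightarrow> nat \<Rightarrow> nat \<Rightarrow> nat" where
  "w_perm_inv n r k l i =
    (if i < k then i else if i < n then i - k + r else if i < n + l then i - n + k
     else if i < n + k then i - (k + l) + r else if i < n + r - l then i - n + l else i)"

text \<open>Expressing everything by the free block sizes \<open>l\<close>,
  \<open>e = k - l\<close>, \<open>c = r - (k + l)\<close> and \<open>f = n + l - r\<close> removes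
  truncated subtraction, with n - k = c + f.\<close>

lemma admissible_sizes:
  fixes n r k l :: nat
  assumes "l \<le> k" "l \<le> r - k" "k \<le> r" "r \<le> n + l" "k \<le> n"
  obtains e c f where "k = l + e" "r = l + e + l + c" "n = l + e + c + f"
proof -
  have "k = l + (k - l)" "r = l + (k - l) + l + (r - (k + l))"
    "n = l + (k - l) + (r - (k + l)) + (n + l - r)"
    using assms by auto
  then show thesis by (rule that)
qed

text \<open>The representative is assembled row by row, so its blocks are first described by the
  column of the 1 in each row.\<close>

definition unit_rows :: "nat \<Rightarrow> nat \<Rightarrow> (nat \<Rightarrow> nat) \<Rightarrow> 'a::semiring_1 mat" where
  "unit_rows m q g = mat m q (\<lambda>(i, j). if j = g i then 1 else 0)"

lemma append_cols_unit_rows: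
  "0\<^sub>m a b @\<^sub>c 0\<^sub>m a c = (0\<^sub>m a (b + c) :: 'a::semiring_1 mat)"
  "1\<^sub>m a @\<^sub>c 0\<^sub>m a b = (unit_rows a (a + b) (\<lambda>i. i) :: 'a mat)"
  "0\<^sub>m a b @\<^sub>c 1\<^sub>m a = (unit_rows a (b + a) (\<lambda>i. b + i) :: 'a mat)"
  "0\<^sub>m a b @\<^sub>c unit_rows a q g = (unit_rows a (b + q) (\<lambda>i. b + g i) :: 'a mat)"
  unfolding append_cols_def unit_rows_def by (rule eq_matI; auto)+

lemma append_rows_unit_rows:
  "unit_rows a q g @\<^sub>r unit_rows b q h
    = (unit_rows (a + b) q (\<lambda>i. if i < a then g i else h (i - a)) :: 'a::semiring_1 mat)"
  unfolding append_rows_def unit_rows_def by (rule eq_matI) auto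

lemma unit_rows_cong:
  "(\<And>i. i < m \<Longrightarrow> g i = h i) \<Longrightarrow> unit_rows m q g = unit_rows m q h"
  by (rule eq_matI) (auto simp: unit_rows_def)

text \<open>An index is replaced by a block offset plus a local index \<open>x\<close>, after which
  simplification decides every branch of the index functions. The sum is nested to the right, as the
  block rows are.\<close>

lemma sum_less_cases6:
  fixes i :: nat
  assumes "i < a + (b + (c + (d + (e + f))))"
  obtains "i < a" | x where "x < b" "i = a + x" | x where "x < c" "i = a + (b + x)"
    | x where "x < d" "i = a + (b + (c + x))" | x where "x < e" "i = a + (b + (c + (d + x)))"
    | x where "x < f" "i = a + (b + (c + (d + (e + x))))"
proof -
  have less_add: "i < a + b \<longleftrightarrow> i < a \<or> (\<exists>x. x < b \<and> i = a + x)" for i a b :: nat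
    by (metis add_less_cancel_left le_add_diff_inverse not_less trans_less_add1)
  from assms show thesis unfolding less_add
  proof (elim disjE exE conjE)
    assume "i < a" then show thesis by (rule that(1))
  next
    fix x assume "x < b" "i = a + x" then show thesis by (rule that(2))
  next
    fix x y assume "x < c" "y = b + x" "i = a + y" then show thesis by (intro that(3)[of x]) simp_all
  next
    fix x y z assume "x < d" "z = c + x" "y = b + z" "i = a + y"
    then show thesis by (intro that(4)[of x]) simp_all
  next
    fix x y z u assume "x < e" "u = d + x" "z = c + u" "y = b + z" "i = a + y"
    then show thesis by (intro that(5)[of x]) simp_all
  next
    fix x y z u v assume "x < f" "v = e + x" "u = d + v" "z = c + u" "y = b + z" "i = a + y"
    then show thesis by (intro that(6)[of x]) simp_all
  qed
qed

lemma w_perm_inverse: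
  assumes "l \<le> k" "l \<le> r - k" "k \<le> r" "r \<le> n + l" "k \<le> n"
  shows "i < n + n \<Longrightarrow> w_perm n r k l (w_perm_inv n r k l i) = i"
    and "j < n + n \<Longrightarrow> w_perm_inv n r k l (w_perm n r k l j) = j"
    and "j < n + n \<Longrightarrow> w_perm n r k l j < n + n"
proof -
  obtain e c f where s: "k = l + e" "r = l + e + l + c" "n = l + e + c + f"
    using assms by (rule admissible_sizes)
  \<comment> \<open>The same size is cut into the heights of the block rows and into the widths of
    the block columns.\<close>
  have rows: "n + n = (l + e) + ((c + f) + (l + (e + (c + f))))"
    and cols: "n + n = (l + e) + (l + (c + ((c + f) + (e + f))))" by (simp_all add: s)
  show "i < n + n \<Longrightarrow> w_perm n r k l (w_perm_inv n r k l i) = i"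
    unfolding rows by (erule sum_less_cases6) (simp_all add: s w_perm_def w_perm_inv_def)
  show "j < n + n \<Longrightarrow> w_perm_inv n r k l (w_perm n r k l j) = j"
    unfolding cols by (erule sum_less_cases6) (simp_all add: s w_perm_def w_perm_inv_def)
  show "w_perm n r k l j < n + n" if "j < n + n"
    using that[unfolded cols] by (rule sum_less_cases6) (simp_all add: s w_perm_def)
qed

text \<open>Assembling the block rows gives a description by rows with \<open>w_perm_inv\<close>; as
  the two index maps are mutually inverse, it turns into the description by columns that the action
  on subspaces needs.\<close>

lemma w_mat_unit_cols:
  assumes "l \<le> k" "l \<le> r - k" "k \<le> r" "r \<le> n + l" "k \<le> n"
  shows "w_mat TYPE('a::field) n r k l = unit_cols (n + n) (n + n) (w_perm n r k l)"
proof -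
  obtain e c f where s: "k = l + e" "r = l + e + l + c" "n = l + e + c + f"
    using assms by (rule admissible_sizes)
  have d: "k - l = e" "n - k = c + f" "r - (k + l) = c" "n + l - r = f"
    by (simp_all add: s)
  let ?\<pi> = "w_perm n r k l" and ?\<sigma> = "w_perm_inv n r k l"
  have rows: "k + (c + f + (l + (e + (c + f)))) = n + n"
    and cols: "k + (l + (c + (c + f + (e + f)))) = n + n" by (simp_all add: s)
  have "w_mat TYPE('a) n r k l = unit_rows (n + n) (n + n) ?\<sigma>"
    unfolding w_mat_def Let_def d append_cols_unit_rows append_rows_unit_rows rows cols
  proof (rule unit_rows_cong)
    fix i assume "i < n + n"
    then show "(if i < k then i
      else if i - k < c + f then k + (l + (c + (i - k)))
      else if i - k - (c + f) < l then k + (i - k - (c + f))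
      else if i - k - (c + f) - l < e then k + (l + (c + (c + f + (i - k - (c + f) - l))))
      else if i - k - (c + f) - l - e < c then k + (l + (i - k - (c + f) - l - e))
      else k + (l + (c + (c + f + (e + (i - k - (c + f) - l - e - c)))))) = ?\<sigma> i"
      unfolding rows[symmetric] by (rule sum_less_cases6) (simp_all add: w_perm_inv_def s)
  qed
  also have "\<dots> = unit_cols (n + n) (n + n) ?\<pi>"
  proof (rule eq_matI)
    fix i j assume "i < dim_row (unit_cols (n + n) (n + n) ?\<pi> :: 'a mat)"
      "j < dim_col (unit_cols (n + n) (n + n) ?\<pi> :: 'a mat)"
    then have ij: "i < n + n" "j < n + n" by auto
    then have "j = ?\<sigma> i \<longleftrightarrow> i = ?\<pi> j" using w_perm_inverse[OF assms] by metis
    with ij show "unit_rows (n + n) (n + n) ?\<sigma> $$ (i, j)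
        = (unit_cols (n + n) (n + n) ?\<pi> $$ (i, j) :: 'a)"
      by (simp add: unit_rows_def)
  qed (simp_all add: unit_rows_def)
  finally show ?thesis .
qed

lemma w_mat_GL:
  assumes "l \<le> k" "l \<le> r - k" "k \<le> r" "r \<le> n + l" "k \<le> n"
  shows "w_mat TYPE('a::field) n r k l \<in> carrier (GL TYPE('a) (n + n))"
proof -
  let ?\<sigma> = "unit_cols (n + n) (n + n) (w_perm_inv n r k l) :: 'a mat"
  have "?\<sigma> * unit_cols (n + n) (n + n) (w_perm n r k l) = unit_cols (n + n) (n + n) (\<lambda>j. j)"
    by (intro unit_cols_mult)
      (use w_perm_inverse(3)[OF assms] in \<open>auto simp: w_perm_inverse(2)[OF assms] not_less[symmetric]\<close>)
  then show ?thesis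
    unfolding w_mat_unit_cols[OF assms] unit_cols_one
    by (intro GL_left_invertible[of _ _ ?\<sigma>]) simp_all
qed

lemma w_mat_first_cols:
  assumes "l \<le> k" "l \<le> r - k" "k \<le> r" "r \<le> n + l" "k \<le> n"
  shows "w_mat TYPE('a::field) n r k l * unit_cols (n + n) r (\<lambda>j. j)
    = unit_cols (n + n) r (w_perm n r k l)"
  unfolding w_mat_unit_cols[OF assms] using assms by (intro unit_cols_mult) auto

text \<open>The first \<open>r\<close> columns span A \<oplus> B, where A is spanned by the unit
  vectors with index below \<open>k\<close>, and B by those with index below \<open>l\<close> or
  from \<open>k\<close> to \<open>r - l - 1\<close>. Hence A \<inter> B has dimension
  \<open>l\<close>.\<close>

lemma w_perm_blocks:
  assumes "l \<le> r - k" "k \<le> r" "k \<le> n"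
  shows "four_block_mat (unit_cols n k (\<lambda>j. j)) (0\<^sub>m n (r - k)) (0\<^sub>m n k)
      (unit_cols n (r - k) (\<lambda>j. if j < l then j else j - l + k))
    = (unit_cols (n + n) r (w_perm n r k l) :: 'a::semiring_1 mat)"
proof (rule eq_matI)
  fix i j assume "i < dim_row (unit_cols (n + n) r (w_perm n r k l) :: 'a mat)"
    "j < dim_col (unit_cols (n + n) r (w_perm n r k l) :: 'a mat)"
  then have ij: "i < n + n" "j < r" by auto
  \<comment> \<open>For \<open>j < r\<close> only three branches survive; the offset
    \<open>n\<close> is taken out so that the rest matches the lower block.\<close>
  have \<pi>: "w_perm n r k l j = (if j < k then j else (if j - k < l then j - k else j - k - l + k) + n)"
    using ij assms by (auto simp: w_perm_def)
  show "four_block_mat (unit_cols n k (\<lambda>j. j)) (0\<^sub>m n (r - k)) (0\<^sub>m n k)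
      (unit_cols n (r - k) (\<lambda>j. if j < l then j else j - l + k)) $$ (i, j)
    = (unit_cols (n + n) r (w_perm n r k l) $$ (i, j) :: 'a)"
  proof (cases "i < n \<or> j < k")
    case True with ij assms \<pi> show ?thesis by (cases "j < k") auto
  next
    case False
    then obtain i' where "i = i' + n" by (metis le_add_diff_inverse2 not_less)
    with False ij assms \<pi> show ?thesis by simp
  qed
qed (use assms in auto)

section \<open>Normal form of a subspace under the Shalika group\<close>

text \<open>The unipotent \<open>s1\<close> splits the subspace into A \<oplus> B, \<open>s2\<close>
  makes A standard, and \<open>s3\<close> normalizes B by an element that stabilizes A.\<close>

lemma shalika_normal_form:
  fixes M :: "'a::field mat"
  assumes M: "M \<in> carrier_mat (n + n) r" and inv: "left_invertible M"
  obtains s h k l where "s \<in> shalika_subgroup TYPE('a) n" "h \<in> carrier (GL TYPE('a) r)"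
    "l \<le> k" "l \<le> r - k" "k \<le> r" "r \<le> n + l" "k \<le> n"
    "s * M * h = unit_cols (n + n) r (w_perm n r k l)"
proof -
  from split_left_invertible[OF M inv] obtain h1 k X1 X2 Y where h1: "h1 \<in> carrier (GL TYPE('a) r)"
    and kr: "k \<le> r" and X1: "X1 \<in> carrier_mat n k" and X2: "X2 \<in> carrier_mat n (r - k)"
    and Y: "Y \<in> carrier_mat n (r - k)" and invs: "left_invertible X1" "left_invertible Y"
    and Mh1: "M * h1 = four_block_mat X1 X2 (0\<^sub>m n k) Y" .
  from left_invertible_normal_form[OF X1 invs(1)] obtain g1 where kn: "k \<le> n"
    and g1: "g1 \<in> carrier (GL TYPE('a) n)" and gX: "g1 * X1 = unit_cols n k (\<lambda>j. j)" by blast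
  note g1c = g1[THEN GL_carrier] and h1c = h1[THEN GL_carrier]
  obtain L where L: "L \<in> carrier_mat (r - k) n" and LY: "L * Y = 1\<^sub>m (r - k)"
    using invs(2) left_invertible_iff[OF Y] by blast
  \<comment> \<open>Because \<open>L * Y = 1\<close>, \<open>x * Y = - X2\<close>, so the unipotent
    element with block \<open>x\<close> clears the upper right block.\<close>
  define x where "x = - (X2 * L)"
  have x: "x \<in> carrier_mat n n" using X2 L by (simp add: x_def)
  have "X2 * L * Y = X2 * (L * Y)" by (rule assoc_mult_mat[OF X2 L Y])
  also have "\<dots> = X2" unfolding LY by (rule right_mult_one_mat[OF X2])
  finally have "x * Y = - X2" unfolding x_def using X2 L Y by (subst uminus_mult_left_mat) auto
  then have xY: "1\<^sub>m n * X2 + x * Y = 0\<^sub>m n (r - k)" using X2 by (simp add: add_uminus_mat)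
  define m where "m = n - k"
  have n: "n = k + m" using kn by (simp add: m_def)
  have g1Y: "g1 * Y \<in> carrier_mat (k + m) (r - k)" using g1c Y n by simp
  have "left_invertible (g1 * Y)"
    by (rule left_invertible_mult[OF g1c Y GL_imp_left_invertible[OF g1] invs(2)])
  from left_invertible_pair_normal_form[OF g1Y this] obtain a b d h2 l
    where a: "a \<in> carrier (GL TYPE('a) k)" and b: "b \<in> carrier_mat k m"
    and d: "d \<in> carrier (GL TYPE('a) m)" and h2: "h2 \<in> carrier (GL TYPE('a) (r - k))"
    and l: "l \<le> r - k" "l \<le> k" "r - k - l \<le> m"
    and gYh: "four_block_mat a b (0\<^sub>m m k) d * (g1 * Y) * h2
      = unit_cols (k + m) (r - k) (\<lambda>j. if j < l then j else j - l + k)" .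
  note ac = a[THEN GL_carrier] and dc = d[THEN GL_carrier] and h2c = h2[THEN GL_carrier]
  obtain a' where a': "a' \<in> carrier (GL TYPE('a) k)" "a * a' = 1\<^sub>m k" using a by (rule GL_inverse)
  note a'c = a'(1)[THEN GL_carrier]
  define g where "g = four_block_mat a b (0\<^sub>m m k) d"
  have g: "g \<in> carrier (GL TYPE('a) n)"
    unfolding g_def n using a b d ac dc by (simp add: four_block_GL_iff)
  note gc = g[THEN GL_carrier]
  define s1 s2 s3 where "s1 = four_block_mat (1\<^sub>m n) x (0\<^sub>m n n) (1\<^sub>m n)"
    and "s2 = four_block_mat g1 (0\<^sub>m n n) (0\<^sub>m n n) g1"
    and "s3 = four_block_mat g (0\<^sub>m n n) (0\<^sub>m n n) g"
  \<comment> \<open>Normalizing B changes the basis of A by \<open>a\<close>; the block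
    \<open>a'\<close> restores it.\<close>
  define h3 where "h3 = four_block_mat a' (0\<^sub>m k (r - k)) (0\<^sub>m (r - k) k) h2"
  have s: "s1 \<in> shalika_subgroup TYPE('a) n" "s2 \<in> shalika_subgroup TYPE('a) n" "s3 \<in> shalika_subgroup TYPE('a) n"
    unfolding shalika_subgroup_def mem_Collect_eq s1_def s2_def s3_def
    using one_GL[where 'a = 'a and n = n] x g1 g zero_carrier_mat[of n n] by blast+
  have sc: "s1 \<in> carrier_mat (n + n) (n + n)" "s2 \<in> carrier_mat (n + n) (n + n)" "s3 \<in> carrier_mat (n + n) (n + n)"
    unfolding s1_def s2_def s3_def using g1c gc by simp_all
  have h3: "h3 \<in> carrier (GL TYPE('a) r)"
    using four_block_GL_iff[OF a'c zero_carrier_mat h2c] a' h2 kr by (simp add: h3_def)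
  note h3c = h3[THEN GL_carrier]
  have E: "unit_cols n k (\<lambda>j. j) \<in> carrier_mat n k" by simp
  have 1: "s1 * (M * h1) = four_block_mat X1 (0\<^sub>m n (r - k)) (0\<^sub>m n k) Y"
    unfolding s1_def Mh1 mult_four_block_upper[OF one_carrier_mat x one_carrier_mat X1 X2 Y] xY
      left_mult_one_mat[OF X1] left_mult_one_mat[OF Y] ..
  have 2: "s2 * \<dots> = four_block_mat (unit_cols n k (\<lambda>j. j)) (0\<^sub>m n (r - k)) (0\<^sub>m n k) (g1 * Y)"
    unfolding s2_def mult_four_block_diag[OF g1c g1c X1 Y] gX ..
  have 3: "s3 * \<dots> = four_block_mat (g * unit_cols n k (\<lambda>j. j)) (0\<^sub>m n (r - k)) (0\<^sub>m n k) (g * (g1 * Y))"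
    unfolding s3_def using g1Y n by (intro mult_four_block_diag[OF gc gc E]) simp
  have "g * unit_cols n k (\<lambda>j. j) = unit_cols n k (\<lambda>j. j) * a"
    unfolding g_def n by (rule four_block_mult_unit_cols_first[OF ac b dc])
  then have "g * unit_cols n k (\<lambda>j. j) * a' = unit_cols n k (\<lambda>j. j) * a * a'" by simp
  also have "\<dots> = unit_cols n k (\<lambda>j. j) * (a * a')" by (rule assoc_mult_mat[OF E ac a'c])
  also have "\<dots> = unit_cols n k (\<lambda>j. j)" unfolding a'(2) by (rule right_mult_one_mat[OF E])
  finally have 4: "g * unit_cols n k (\<lambda>j. j) * a' = unit_cols n k (\<lambda>j. j)" .
  have gE: "g * unit_cols n k (\<lambda>j. j) \<in> carrier_mat n k" "g * (g1 * Y) \<in> carrier_mat n (r - k)"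
    using gc g1Y n by simp_all
  have "four_block_mat (g * unit_cols n k (\<lambda>j. j)) (0\<^sub>m n (r - k)) (0\<^sub>m n k) (g * (g1 * Y)) * h3
    = four_block_mat (unit_cols n k (\<lambda>j. j)) (0\<^sub>m n (r - k)) (0\<^sub>m n k)
        (unit_cols n (r - k) (\<lambda>j. if j < l then j else j - l + k))"
    unfolding h3_def mult_four_block_diag[OF gE a'c h2c] 4 gYh[folded g_def n] ..
  also have "\<dots> = unit_cols (n + n) r (w_perm n r k l)"
    by (rule w_perm_blocks[OF l(1) kr kn])
  finally have 5: "s3 * (s2 * (s1 * (M * h1))) * h3 = unit_cols (n + n) r (w_perm n r k l)"
    unfolding 1 2 3 .
  have Mh: "M * h1 \<in> carrier_mat (n + n) r" using M h1c by simp
  have "s3 * s2 * s1 * M * (h1 * h3) = s3 * s2 * s1 * M * h1 * h3"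
    using sc M h1c h3c by (intro assoc_mult_mat[symmetric]) auto
  also have "s3 * s2 * s1 * M * h1 = s3 * s2 * s1 * (M * h1)"
    using sc M h1c by (intro assoc_mult_mat) auto
  also have "\<dots> = s3 * s2 * (s1 * (M * h1))"
    using sc Mh by (intro assoc_mult_mat) auto
  also have "\<dots> = s3 * (s2 * (s1 * (M * h1)))"
    using sc Mh by (intro assoc_mult_mat) auto
  also note 5
  finally have eq: "s3 * s2 * s1 * M * (h1 * h3) = unit_cols (n + n) r (w_perm n r k l)" .
  have "s3 * s2 * s1 \<in> shalika_subgroup TYPE('a) n"
    using s subgroup.m_closed[OF subgroup_shalika[where 'a = 'a and n = n]] by (simp add: GL_simps)
  \<comment> \<open>The bound \<open>r - k - l \<le> m\<close> with \<open>m = n - k\<close> says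
    that A + B fits into dimension \<open>n\<close>.\<close>
  moreover have "r \<le> n + l" using l n kr by simp
  ultimately show thesis
    using that[OF _ mult_GL[OF h1 h3] l(2,1) kr _ kn eq] by blast
qed

section \<open>Ranks as invariants of the orbits\<close>

text \<open>This says that the rank of \<open>A\<close> is at most \<open>t\<close>.\<close>

definition factors_through :: "'a::semiring_1 mat \<Rightarrow> nat \<Rightarrow> bool" where
  "factors_through A t \<longleftrightarrow>
    (\<exists>B \<in> carrier_mat (dim_row A) t. \<exists>C \<in> carrier_mat t (dim_col A). A = B * C)"

lemma factors_through_mult:
  fixes A :: "'a::semiring_1 mat"
  assumes "factors_through A t" and A: "A \<in> carrier_mat m q"
    and P: "P \<in> carrier_mat p m" and Q: "Q \<in> carrier_mat q s"
  shows "factors_through (P * A * Q) t"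
proof -
  obtain B C where B: "B \<in> carrier_mat m t" and C: "C \<in> carrier_mat t q" and AB: "A = B * C"
    using assms(1) A unfolding factors_through_def by auto
  have PB: "P * B \<in> carrier_mat p t" using P B by simp
  have "P * A * Q = P * B * C * Q" unfolding AB assoc_mult_mat[OF P B C] ..
  also have "\<dots> = (P * B) * (C * Q)" by (rule assoc_mult_mat[OF PB C Q])
  finally have "P * A * Q = (P * B) * (C * Q)" .
  moreover have "dim_row (P * A * Q) = p" "dim_col (P * A * Q) = s" using P Q by auto
  moreover have "C * Q \<in> carrier_mat t s" using C Q by simp
  ultimately show ?thesis unfolding factors_through_def using PB by metis
qed

text \<open>In 1 = B C the factor \<open>C\<close> has \<open>c\<close> columns, \<open>t\<close>
  rows and the left inverse \<open>B\<close>, so the dimension bound for left invertible matrices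
  applies.\<close>

lemma factors_through_one:
  assumes "factors_through (1\<^sub>m c :: 'a::field mat) t"
  shows "c \<le> t"
proof -
  obtain B C where "B \<in> carrier_mat c t" and C: "C \<in> carrier_mat t c" and "(1\<^sub>m c :: 'a mat) = B * C"
    using assms unfolding factors_through_def by auto
  then have "left_invertible C" using left_invertible_iff[OF C] by metis
  then show ?thesis by (rule left_invertible_normal_form(1)[OF C])
qed

text \<open>The rank is the number of distinct nonzero columns. Enumerating them gives a
  factorization, and cutting out one row and one column for each of them leaves an identity
  matrix.\<close>

lemma factors_through_unit_cols:
  "factors_through (unit_cols m q f :: 'a::field mat) t \<longleftrightarrow> card (f ` {..<q} \<inter> {..<m}) \<le> t"
proof -
  define I where "I = f ` {..<q} \<inter> {..<m}"
  define c where "c = card I"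
  have "finite I" by (simp add: I_def)
  from ex_bij_betw_nat_finite[OF this] obtain e where e: "bij_betw e {..<c} I"
    by (auto simp: c_def lessThan_atLeast0)
  define e' where "e' = inv_into {..<c} e"
  have e'_less: "e' i < c" and e_e': "e (e' i) = i" if "i \<in> I" for i
    using that bij_betw_imp_surj_on[OF e] inv_into_into[of i e "{..<c}"]
      f_inv_into_f[of i e "{..<c}"] by (auto simp: e'_def)
  have e_I: "e x \<in> I" and e'_e: "e' (e x) = x" if "x < c" for x
    using that e bij_betw_inv_into_left[OF e] by (auto simp: e'_def bij_betw_def)
  show ?thesis unfolding I_def[symmetric] c_def[symmetric]
  proof
    assume "c \<le> t"
    \<comment> \<open>The left factor lists the distinct columns and the right one records which of
      them stands in place \<open>j\<close>; the values \<open>m\<close> and \<open>t\<close> are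
      out of range and give zero columns.\<close>
    then have "unit_cols m t (\<lambda>x. if x < c then e x else m) *
      unit_cols t q (\<lambda>j. if f j < m then e' (f j) else t) = (unit_cols m q f :: 'a mat)"
      using e'_less e_e' by (intro unit_cols_mult) (force simp: I_def split: if_splits)+
    from this[symmetric] show "factors_through (unit_cols m q f :: 'a mat) t"
      unfolding factors_through_def unit_cols_dim
      by (rule bexI[OF bexI[OF _ unit_cols_carrier] unit_cols_carrier])
  next
    assume *: "factors_through (unit_cols m q f :: 'a mat) t"
    have "\<forall>x \<in> {..<c}. \<exists>j. j < q \<and> f j = e x" using e_I by (force simp: I_def)
    then obtain h where h: "\<And>x. x < c \<Longrightarrow> h x < q \<and> f (h x) = e x" by (metis lessThan_iff)
    have 1: "unit_cols c m (\<lambda>i. if i \<in> I then e' i else c) * unit_cols m q f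
        = (unit_cols c q (\<lambda>j. if f j \<in> I then e' (f j) else c) :: 'a mat)"
      by (rule unit_cols_mult) (auto simp: I_def)
    have 2: "unit_cols c q (\<lambda>j. if f j \<in> I then e' (f j) else c) * unit_cols q c h
        = (unit_cols c c (\<lambda>x. x) :: 'a mat)"
      using h e_I e'_e by (intro unit_cols_mult) (auto simp: not_le[symmetric])
    have "factors_through (unit_cols c m (\<lambda>i. if i \<in> I then e' i else c) * unit_cols m q f
        * unit_cols q c h :: 'a mat) t"
      by (rule factors_through_mult[OF * unit_cols_carrier unit_cols_carrier unit_cols_carrier])
    then show "c \<le> t" unfolding 1 2 unit_cols_one by (rule factors_through_one)
  qed
qed

lemma append_cols_carrier:
  "A \<in> carrier_mat m p \<Longrightarrow> B \<in> carrier_mat m q \<Longrightarrow> A @\<^sub>c B \<in> carrier_mat m (p + q)"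
  unfolding append_cols_def by auto

lemma mult_append_cols:
  fixes A :: "'a::semiring_1 mat"
  assumes S: "S \<in> carrier_mat l m" and A: "A \<in> carrier_mat m p" and B: "B \<in> carrier_mat m q"
  shows "S * (A @\<^sub>c B) = S * A @\<^sub>c S * B"
proof -
  have "S = four_block_mat S (0\<^sub>m l 0) (0\<^sub>m 0 m) (0\<^sub>m 0 0)" using S by (intro eq_matI) auto
  then have "S * (A @\<^sub>c B) = four_block_mat S (0\<^sub>m l 0) (0\<^sub>m 0 m) (0\<^sub>m 0 0) *
      four_block_mat A B (0\<^sub>m 0 p) (0\<^sub>m 0 q)"
    using A B by (simp add: append_cols_def)
  also have "\<dots> = four_block_mat (S * A) (S * B) (0\<^sub>m 0 p) (0\<^sub>m 0 q)"
    using S A B by (subst mult_four_block_mat[of _ l m _ 0 _ 0 _ _ p _ q]) auto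
  finally show ?thesis using A B by (simp add: append_cols_def)
qed

lemma append_cols_mult:
  fixes A :: "'a::semiring_1 mat"
  assumes A: "A \<in> carrier_mat m p" and B: "B \<in> carrier_mat m q"
    and h: "h \<in> carrier_mat p p'" and h': "h' \<in> carrier_mat q q'"
  shows "(A @\<^sub>c B) * four_block_mat h (0\<^sub>m p q') (0\<^sub>m q p') h' = A * h @\<^sub>c B * h'"
proof -
  have "(A @\<^sub>c B) * four_block_mat h (0\<^sub>m p q') (0\<^sub>m q p') h' =
      four_block_mat A B (0\<^sub>m 0 p) (0\<^sub>m 0 q) * four_block_mat h (0\<^sub>m p q') (0\<^sub>m q p') h'"
    using A B by (simp add: append_cols_def)
  also have "\<dots> = four_block_mat (A * h) (B * h') (0\<^sub>m 0 p') (0\<^sub>m 0 q')"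
    using A B h h' by (subst mult_four_block_mat[of _ m p _ q _ 0 _ _ p' _ q']) auto
  finally show ?thesis using h h' by (simp add: append_cols_def)
qed

text \<open>This is the nilpotent N, sending (u, v) to (v, 0).\<close>

definition shift_mat :: "nat \<Rightarrow> 'a::semiring_1 mat" where
  "shift_mat n = four_block_mat (0\<^sub>m n n) (1\<^sub>m n) (0\<^sub>m n n) (0\<^sub>m n n)"

lemma shift_mat_carrier: "shift_mat n \<in> carrier_mat (n + n) (n + n)"
  by (simp add: shift_mat_def)

lemma shift_mat_commute:
  assumes "s \<in> shalika_subgroup TYPE('a::field) n"
  shows "shift_mat n * s = s * shift_mat n"
proof -
  obtain g x where s: "s = four_block_mat g x (0\<^sub>m n n) g"
    and g: "g \<in> carrier_mat n n" and x: "x \<in> carrier_mat n n"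
    using assms by (auto simp: shalika_subgroup_def GL_carrier)
  show ?thesis
    unfolding s shift_mat_def using g x
    by (simp add: mult_four_block_upper[of _ n n _ n _ n _ n _ n])
qed

text \<open>As N commutes with \<open>s\<close>, \<open>N * (s * A * h) = s * (N * A) * h\<close>,
  and the matrix with both halves side by side becomes \<open>s\<close> times the old one times
  diag(h, h). Neither rank can grow. For a basis \<open>A\<close> of W these ranks are dim (N W) and
  dim (W + N W).\<close>

lemma shalika_rank_invariants:
  assumes s: "s \<in> shalika_subgroup TYPE('a::field) n" and A: "A \<in> carrier_mat (n + n) r"
    and h: "h \<in> carrier_mat r r"
  shows "factors_through (shift_mat n * A) t \<Longrightarrow> factors_through (shift_mat n * (s * A * h)) t"
    and "factors_through (A @\<^sub>c shift_mat n * A) t \<Longrightarrow>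
      factors_through ((s * A * h) @\<^sub>c shift_mat n * (s * A * h)) t"
proof -
  let ?N = "shift_mat n :: 'a mat"
  have N: "?N \<in> carrier_mat (n + n) (n + n)" by (rule shift_mat_carrier)
  have sc: "s \<in> carrier_mat (n + n) (n + n)"
    using s by (auto simp: shalika_subgroup_def GL_carrier)
  have NA: "?N * A \<in> carrier_mat (n + n) r" and sA: "s * A \<in> carrier_mat (n + n) r"
    and sNA: "s * (?N * A) \<in> carrier_mat (n + n) r"
    using N A sc by simp_all
  have eq: "?N * (s * A * h) = s * (?N * A) * h"
    unfolding assoc_mult_mat[OF N sA h, symmetric] assoc_mult_mat[OF N sc A, symmetric]
      shift_mat_commute[OF s] assoc_mult_mat[OF sc N A] ..
  show "factors_through (?N * (s * A * h)) t" if "factors_through (?N * A) t"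
    unfolding eq by (rule factors_through_mult[OF that NA sc h])
  show "factors_through ((s * A * h) @\<^sub>c ?N * (s * A * h)) t" if "factors_through (A @\<^sub>c ?N * A) t"
    unfolding eq append_cols_mult[OF sA sNA h h, symmetric] mult_append_cols[OF sc A NA, symmetric]
    by (rule factors_through_mult[OF that append_cols_carrier[OF A NA] sc four_block_carrier_mat[OF h h]])
qed

text \<open>Unit vectors of the first summand are killed, which the out-of-range value
  \<open>n + n\<close> expresses.\<close>

lemma shift_mat_unit_cols:
  assumes "\<And>j. j < r \<Longrightarrow> f j < n + n"
  shows "shift_mat n * unit_cols (n + n) r f
    = (unit_cols (n + n) r (\<lambda>j. if f j < n then n + n else f j - n) :: 'a::semiring_1 mat)"
proof -
  have "shift_mat n = (unit_cols (n + n) (n + n) (\<lambda>j. if j < n then n + n else j - n) :: 'a mat)"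
    unfolding shift_mat_def by (rule eq_matI) auto
  then show ?thesis
    using assms by (auto intro!: unit_cols_mult simp: not_le[symmetric])
qed

lemma append_cols_unit_cols:
  "unit_cols m p f @\<^sub>c unit_cols m q g
    = (unit_cols m (p + q) (\<lambda>j. if j < p then f j else g (j - p)) :: 'a::semiring_1 mat)"
  unfolding append_cols_def by (rule eq_matI) auto

lemma w_perm_less: "l \<le> k \<Longrightarrow> j < r \<Longrightarrow> r \<le> n + l \<Longrightarrow> k \<le> n \<Longrightarrow> w_perm n r k l j < n + n"
  by (auto simp: w_perm_def)

text \<open>All columns are unit vectors or zero, so both ranks are found by counting
  indices.\<close>

lemma w_perm_ranks:
  assumes "l \<le> k" "l \<le> r - k" "k \<le> r" "r \<le> n + l" "k \<le> n"
  defines "W \<equiv> unit_cols (n + n) r (w_perm n r k l) :: 'a::field mat"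
  shows "factors_through (shift_mat n * W) t \<longleftrightarrow> r - k \<le> t"
    and "factors_through (W @\<^sub>c shift_mat n * W) t \<longleftrightarrow> r + r - k - l \<le> t"
proof -
  obtain e c d where s: "k = l + e" "r = l + e + l + c" "n = l + e + c + d"
    using assms(1-5) by (rule admissible_sizes)
  define \<pi> where "\<pi> = w_perm n r k l"
  \<comment> \<open>\<open>\<nu>\<close> gives the columns of N W, and \<open>\<rho>\<close> those
    of W followed by those of N W.\<close>
  define \<nu> where "\<nu> j = (if \<pi> j < n then n + n else \<pi> j - n)" for j
  define \<rho> where "\<rho> j = (if j < r then \<pi> j else \<nu> (j - r))" for j
  have \<pi>_less: "\<pi> j < n + n" if "j < r" for j
    unfolding \<pi>_def using that assms by (intro w_perm_less)
  have \<pi>_eq: "x < k \<Longrightarrow> \<pi> x = x" "x < l \<Longrightarrow> \<pi> (k + x) = n + x" "x < c \<Longrightarrow> \<pi> (k + l + x) = n + k + x" for x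
    using s by (simp_all add: \<pi>_def w_perm_def)
  have \<nu>_eq: "x < k \<Longrightarrow> \<nu> x = n + n" "x < l \<Longrightarrow> \<nu> (k + x) = x" "x < c \<Longrightarrow> \<nu> (k + l + x) = k + x" for x
    using assms(5) by (simp_all add: \<nu>_def \<pi>_eq)
  have NW: "shift_mat n * W = unit_cols (n + n) r \<nu>"
    unfolding W_def \<pi>_def[symmetric] \<nu>_def using \<pi>_less by (rule shift_mat_unit_cols)
  have dom: "{..<r} = {..<k} \<union> (\<lambda>x. k + x) ` {..<l} \<union> (\<lambda>x. k + l + x) ` {..<c}"
    unfolding lessThan_atLeast0 image_add_atLeastLessThan using s by auto
  have im: "\<phi> ` {..<r} = \<phi> ` {..<k} \<union> (\<lambda>x. \<phi> (k + x)) ` {..<l} \<union> (\<lambda>x. \<phi> (k + l + x)) ` {..<c}"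
    for \<phi> :: "nat \<Rightarrow> nat"
    unfolding dom image_Un image_image ..
  have shift: "(\<lambda>x. a + x) ` {..<b} = {a..<a + b}" for a b :: nat
    unfolding lessThan_atLeast0 image_add_atLeastLessThan by (simp add: add.commute)
  have "\<pi> ` {..<k} = {..<k}" "(\<lambda>x. \<pi> (k + x)) ` {..<l} = (\<lambda>x. n + x) ` {..<l}"
    "(\<lambda>x. \<pi> (k + l + x)) ` {..<c} = (\<lambda>x. n + k + x) ` {..<c}"
    using \<pi>_eq by simp_all
  then have im_\<pi>: "\<pi> ` {..<r} = {..<k} \<union> {n..<n + l} \<union> {n + k..<n + k + c}"
    unfolding im shift by simp
  have "\<nu> ` {..<k} \<subseteq> {n + n}" "(\<lambda>x. \<nu> (k + x)) ` {..<l} = {..<l}"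
    "(\<lambda>x. \<nu> (k + l + x)) ` {..<c} = (\<lambda>x. k + x) ` {..<c}"
    using \<nu>_eq by auto
  moreover have "{..<l} \<union> {k..<k + c} \<subseteq> {..<n + n}" using s by auto
  moreover have "V \<subseteq> {a} \<Longrightarrow> A \<union> B \<subseteq> U \<Longrightarrow> a \<notin> U \<Longrightarrow> (V \<union> A \<union> B) \<inter> U = A \<union> B"
    for V A B U :: "nat set" and a by blast
  ultimately have im_\<nu>: "\<nu> ` {..<r} \<inter> {..<n + n} = {..<l} \<union> {k..<k + c}"
    unfolding im shift by simp
  have sizes: "r - k = l + c" "r + r - k - l = k + c + (l + c)" "k + c \<le> n"
    by (simp_all add: s)
  have "card ({..<l} \<union> {k..<k + c}) = r - k"
    using assms(1) unfolding sizes by (subst card_Un_disjoint) auto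
  then show "factors_through (shift_mat n * W) t \<longleftrightarrow> r - k \<le> t"
    unfolding NW factors_through_unit_cols im_\<nu> by simp
  have "{..<r + r} = {..<r} \<union> (\<lambda>j. j + r) ` {..<r}"
    unfolding lessThan_atLeast0 image_add_atLeastLessThan' by auto
  moreover have "\<rho> ` {..<r} = \<pi> ` {..<r}"
    by (rule image_cong) (simp_all add: \<rho>_def)
  moreover have "\<rho> ` (\<lambda>j. j + r) ` {..<r} = \<nu> ` {..<r}"
    unfolding image_image by (rule image_cong) (simp_all add: \<rho>_def)
  ultimately have "\<rho> ` {..<r + r} = \<pi> ` {..<r} \<union> \<nu> ` {..<r}"
    by (simp only: image_Un)
  then have "\<rho> ` {..<r + r} \<inter> {..<n + n} = (\<pi> ` {..<r} \<inter> {..<n + n}) \<union> (\<nu> ` {..<r} \<inter> {..<n + n})"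
    by blast
  also have "\<dots> = {..<k + c} \<union> ({n..<n + l} \<union> {n + k..<n + k + c})"
  proof -
    have "\<pi> ` {..<r} \<inter> {..<n + n} = \<pi> ` {..<r}" using \<pi>_less by auto
    moreover have "{..<k + c} = {..<k} \<union> {k..<k + c}" "{..<l} \<subseteq> {..<k}" using s by auto
    moreover have "L \<subseteq> A \<Longrightarrow> A \<union> X \<union> Y \<union> (L \<union> K) = A \<union> K \<union> (X \<union> Y)"
      for A K L X Y :: "nat set" by blast
    ultimately show ?thesis unfolding im_\<nu> by (simp only: im_\<pi>)
  qed
  finally have im_\<rho>: "\<rho> ` {..<r + r} \<inter> {..<n + n} = {..<k + c} \<union> ({n..<n + l} \<union> {n + k..<n + k + c})" .
  have "card ({n..<n + l} \<union> {n + k..<n + k + c}) = l + c"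
    using assms(1) by (subst card_Un_disjoint) auto
  then have "card ({..<k + c} \<union> ({n..<n + l} \<union> {n + k..<n + k + c})) = r + r - k - l"
    using sizes(3) unfolding sizes by (subst card_Un_disjoint) auto
  then show "factors_through (W @\<^sub>c shift_mat n * W) t \<longleftrightarrow> r + r - k - l \<le> t"
    unfolding NW unfolding W_def \<pi>_def[symmetric] append_cols_unit_cols \<rho>_def[symmetric]
      factors_through_unit_cols im_\<rho> by simp
qed

section \<open>Covering and disjointness of the double cosets\<close>

text \<open>Restricting the equation to the first \<open>r\<close> columns turns \<open>p\<close>
  into its corner \<open>h\<close>, so \<open>?W = s * ?W' * h\<close> and the ranks for
  \<open>?W\<close> are at most those for \<open>?W'\<close>. Exchanging the two representatives
  will give equality.\<close>

lemma w_mat_same_double_coset_le: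
  assumes kl: "l \<le> k" "l \<le> r - k" "k \<le> r" "r \<le> n + l" "k \<le> n"
    and kl': "l' \<le> k'" "l' \<le> r - k'" "k' \<le> r" "r \<le> n + l'" "k' \<le> n"
    and s: "s \<in> shalika_subgroup TYPE('a::field) n"
    and p: "p \<in> parabolic_subgroup TYPE('a) r (n + n - r)"
    and eq: "w_mat TYPE('a) n r k l = s * w_mat TYPE('a) n r k' l' * p"
  shows "r - k \<le> r - k'" "r + r - k - l \<le> r + r - k' - l'"
proof -
  let ?E = "unit_cols (n + n) r (\<lambda>j. j) :: 'a mat"
  let ?W = "unit_cols (n + n) r (w_perm n r k l) :: 'a mat"
  let ?w' = "w_mat TYPE('a) n r k' l'"
  let ?W' = "unit_cols (n + n) r (w_perm n r k' l') :: 'a mat"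
  obtain m where m: "n + n = r + m" using kl by (metis add.assoc le_add_diff_inverse add_le_mono le_trans)
  obtain h x y where pb: "p = four_block_mat h x (0\<^sub>m m r) y"
    and h: "h \<in> carrier_mat r r" and x: "x \<in> carrier_mat r m" and y: "y \<in> carrier_mat m m"
    using p m by (auto simp: parabolic_subgroup_def GL_carrier)
  have sc: "s \<in> carrier_mat (n + n) (n + n)"
    using s by (auto simp: shalika_subgroup_def GL_carrier)
  have w'c: "?w' \<in> carrier_mat (n + n) (n + n)" by (rule GL_carrier[OF w_mat_GL[OF kl']])
  have pc: "p \<in> carrier_mat (n + n) (n + n)"
    unfolding m pb by (rule four_block_carrier_mat[OF h y])
  have E: "?E \<in> carrier_mat (n + n) r" by simp
  have sw: "s * ?w' \<in> carrier_mat (n + n) (n + n)" using sc w'c by simp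
  have "?W = s * ?w' * p * ?E" unfolding w_mat_first_cols[OF kl, symmetric] eq ..
  also have "\<dots> = s * ?w' * (p * ?E)" by (rule assoc_mult_mat[OF sw pc E])
  also have "p * ?E = ?E * h"
    unfolding pb m by (rule four_block_mult_unit_cols_first[OF h x y])
  also have "s * ?w' * (?E * h) = s * ?w' * ?E * h" by (rule assoc_mult_mat[OF sw E h, symmetric])
  also have "s * ?w' * ?E = s * ?W'"
    unfolding assoc_mult_mat[OF sc w'c E] w_mat_first_cols[OF kl'] ..
  finally have W: "?W = s * ?W' * h" .
  \<comment> \<open>The bound \<open>t\<close> is taken to be the exact rank \<open>r - k'\<close>
    for \<open>?W'\<close>.\<close>
  show "r - k \<le> r - k'"
    using shalika_rank_invariants(1)[OF s unit_cols_carrier h]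
      w_perm_ranks(1)[OF kl, where 'a = 'a] w_perm_ranks(1)[OF kl', where 'a = 'a] W by (metis order_refl)
  show "r + r - k - l \<le> r + r - k' - l'"
    using shalika_rank_invariants(2)[OF s unit_cols_carrier h]
      w_perm_ranks(2)[OF kl, where 'a = 'a] w_perm_ranks(2)[OF kl', where 'a = 'a] W by (metis order_refl)
qed

lemma double_coset_GL_iff:
  "x \<in> double_coset (GL TYPE('a::field) n) H g K \<longleftrightarrow> (\<exists>h \<in> H. \<exists>k \<in> K. x = h * g * k)"
  by (auto simp: double_coset_def r_coset_def set_mult_def GL_simps)

lemma subgroup_GL_inverse:
  assumes "subgroup H (GL TYPE('a::field) n)" "A \<in> H"
  obtains B where "B \<in> H" "A * B = 1\<^sub>m n" "B * A = 1\<^sub>m n"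
proof -
  interpret group "GL TYPE('a) n" by (rule group_GL)
  show thesis
    by (rule that[OF subgroup.m_inv_closed[OF assms]])
      (use r_inv[OF subgroup.mem_carrier[OF assms]] l_inv[OF subgroup.mem_carrier[OF assms]]
        in \<open>simp_all add: GL_simps\<close>)
qed

text \<open>The first \<open>r\<close> columns of \<open>x\<close> form a basis, and bringing it to
  normal form by \<open>s\<close> and \<open>h\<close> shows that \<open>s * x\<close> and the
  representative have the same span of first columns, hence differ by a parabolic factor.\<close>

lemma w_mat_double_coset_cover:
  assumes "x \<in> carrier (GL TYPE('a::field) (n + n))" and r: "r \<le> n + n"
  obtains k l where "l \<le> k" "l \<le> r - k" "k \<le> r" "r \<le> n + l" "k \<le> n"
    "\<exists>s \<in> shalika_subgroup TYPE('a) n. \<exists>p \<in> parabolic_subgroup TYPE('a) r (n + n - r).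
      x = s * w_mat TYPE('a) n r k l * p"
proof -
  define m where "m = n + n - r"
  have m: "n + n = r + m" using r by (simp add: m_def)
  let ?E = "unit_cols (n + n) r (\<lambda>j. j) :: 'a mat"
  have E: "?E \<in> carrier_mat (n + n) r" by simp
  have xc: "x \<in> carrier_mat (n + n) (n + n)" using assms(1) by (rule GL_carrier)
  have "unit_cols r (n + n) (\<lambda>j. j) * ?E = 1\<^sub>m r"
    unfolding unit_cols_one[symmetric] using r by (intro unit_cols_mult) auto
  then have "left_invertible ?E"
    unfolding left_invertible_iff[OF E] using unit_cols_carrier by blast
  then have "left_invertible (x * ?E)"
    by (rule left_invertible_mult[OF xc E GL_imp_left_invertible[OF assms(1)]])
  from shalika_normal_form[OF mult_carrier_mat[OF xc E] this] obtain s h k l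
    where s: "s \<in> shalika_subgroup TYPE('a) n" and h: "h \<in> carrier (GL TYPE('a) r)"
    and kl: "l \<le> k" "l \<le> r - k" "k \<le> r" "r \<le> n + l" "k \<le> n"
    and sxh: "s * (x * ?E) * h = unit_cols (n + n) r (w_perm n r k l)" .
  let ?w = "w_mat TYPE('a) n r k l"
  note hc = h[THEN GL_carrier]
  have w: "?w \<in> carrier (GL TYPE('a) (n + n))" by (rule w_mat_GL[OF kl])
  have sG: "s \<in> carrier (GL TYPE('a) (n + n))" by (rule subgroup.mem_carrier[OF subgroup_shalika s])
  note wc = w[THEN GL_carrier] and sc = sG[THEN GL_carrier]
  obtain v where v: "v \<in> carrier (GL TYPE('a) (n + n))" "?w * v = 1\<^sub>m (n + n)" "v * ?w = 1\<^sub>m (n + n)"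
    using w by (rule GL_inverse)
  obtain s' where s': "s' \<in> shalika_subgroup TYPE('a) n" "s' * s = 1\<^sub>m (n + n)"
    using subgroup_shalika s by (rule subgroup_GL_inverse)
  obtain h' where h': "h' \<in> carrier (GL TYPE('a) r)" "h * h' = 1\<^sub>m r"
    using h by (rule GL_inverse)
  note vc = v(1)[THEN GL_carrier] and h'c = h'(1)[THEN GL_carrier]
  have s'c: "s' \<in> carrier_mat (n + n) (n + n)"
    by (rule GL_carrier[OF subgroup.mem_carrier[OF subgroup_shalika s'(1)]])
  \<comment> \<open>This is the only candidate for the factor; \<open>p * ?E * h = ?E\<close> then
    shows that it preserves the span of the first \<open>r\<close> unit vectors.\<close>
  define p where "p = v * (s * x)"
  have sx: "s * x \<in> carrier_mat (n + n) (n + n)" using sc xc by simp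
  have p: "p \<in> carrier (GL TYPE('a) (n + n))"
    unfolding p_def using v sG assms(1) by (intro mult_GL)
  note pc = p[THEN GL_carrier]
  have pE: "p * ?E \<in> carrier_mat (n + n) r" using pc by simp
  have sxE: "s * (x * ?E) \<in> carrier_mat (n + n) r" using sc xc by simp
  have "p * ?E = v * (s * (x * ?E))"
    unfolding p_def assoc_mult_mat[OF vc sx E] assoc_mult_mat[OF sc xc E] ..
  then have "p * ?E * h = v * (s * (x * ?E) * h)"
    using assoc_mult_mat[OF vc sxE hc] by simp
  also have "\<dots> = v * (?w * ?E)" unfolding sxh w_mat_first_cols[OF kl] ..
  also have "\<dots> = v * ?w * ?E" by (rule assoc_mult_mat[OF vc wc E, symmetric])
  also have "\<dots> = ?E" unfolding v(3) by (rule left_mult_one_mat[OF E])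
  finally have "p * ?E * h * h' = ?E * h'" by simp
  moreover have "p * ?E * h * h' = p * ?E * (h * h')" by (rule assoc_mult_mat[OF pE hc h'c])
  moreover have "p * ?E * (h * h') = p * ?E" unfolding h'(2) by (rule right_mult_one_mat[OF pE])
  ultimately have "p * ?E = ?E * h'" by simp
  from four_block_of_mult_unit_cols_first[OF pc[unfolded m] h'c this[unfolded m]]
  obtain y z where yz: "y \<in> carrier_mat r m" "z \<in> carrier_mat m m"
    "p = four_block_mat h' y (0\<^sub>m m r) z" by blast
  have "p \<in> parabolic_subgroup TYPE('a) r m"
    unfolding parabolic_subgroup_def mem_Collect_eq
    using p h'(1) yz four_block_GL_iff[OF h'c yz(1,2)] m by auto
  moreover have "x = s' * ?w * p"
  proof -
    have "?w * p = ?w * v * (s * x)" unfolding p_def by (rule assoc_mult_mat[OF wc vc sx, symmetric])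
    also have "\<dots> = s * x" unfolding v(2) by (rule left_mult_one_mat[OF sx])
    finally have "s' * (?w * p) = s' * s * x" using assoc_mult_mat[OF s'c sc xc] by simp
    also have "\<dots> = x" unfolding s'(2) by (rule left_mult_one_mat[OF xc])
    finally show ?thesis unfolding assoc_mult_mat[OF s'c wc pc] by simp
  qed
  ultimately show thesis using that[OF kl] s'(1) unfolding m_def by blast
qed

lemma double_coset_overlap:
  assumes H: "subgroup H (GL TYPE('a::field) n)" and K: "subgroup K (GL TYPE('a) n)"
    and g: "g \<in> carrier (GL TYPE('a) n)" and g': "g' \<in> carrier (GL TYPE('a) n)"
    and x: "x \<in> double_coset (GL TYPE('a) n) H g K" "x \<in> double_coset (GL TYPE('a) n) H g' K"
  shows "\<exists>h \<in> H. \<exists>k \<in> K. g = h * g' * k"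
proof -
  interpret group "GL TYPE('a) n" by (rule group_GL)
  let ?G = "GL TYPE('a) n"
  obtain h k h' k' where *: "h \<in> H" "k \<in> K" "h' \<in> H" "k' \<in> K" "x = h * g * k" "x = h' * g' * k'"
    using x unfolding double_coset_GL_iff by blast
  have c: "h \<in> carrier ?G" "h' \<in> carrier ?G" "k \<in> carrier ?G" "k' \<in> carrier ?G"
    using * subgroup.mem_carrier[OF H] subgroup.mem_carrier[OF K] by auto
  have "h \<otimes>\<^bsub>?G\<^esub> g \<otimes>\<^bsub>?G\<^esub> k = h' \<otimes>\<^bsub>?G\<^esub> g' \<otimes>\<^bsub>?G\<^esub> k'"
    using *(5,6) by (simp add: GL_simps)
  then have "inv\<^bsub>?G\<^esub> h \<otimes>\<^bsub>?G\<^esub> (h \<otimes>\<^bsub>?G\<^esub> g \<otimes>\<^bsub>?G\<^esub> k) \<otimes>\<^bsub>?G\<^esub> inv\<^bsub>?G\<^esub> k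
    = (inv\<^bsub>?G\<^esub> h \<otimes>\<^bsub>?G\<^esub> h') \<otimes>\<^bsub>?G\<^esub> g' \<otimes>\<^bsub>?G\<^esub> (k' \<otimes>\<^bsub>?G\<^esub> inv\<^bsub>?G\<^esub> k)"
    using c g' by (simp add: m_assoc)
  moreover have "inv\<^bsub>?G\<^esub> h \<otimes>\<^bsub>?G\<^esub> (h \<otimes>\<^bsub>?G\<^esub> g \<otimes>\<^bsub>?G\<^esub> k) \<otimes>\<^bsub>?G\<^esub> inv\<^bsub>?G\<^esub> k
    = (inv\<^bsub>?G\<^esub> h \<otimes>\<^bsub>?G\<^esub> h) \<otimes>\<^bsub>?G\<^esub> g \<otimes>\<^bsub>?G\<^esub> (k \<otimes>\<^bsub>?G\<^esub> inv\<^bsub>?G\<^esub> k)"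
    using c g by (simp only: m_assoc m_closed inv_closed)
  ultimately have "g = (inv\<^bsub>?G\<^esub> h \<otimes>\<^bsub>?G\<^esub> h') \<otimes>\<^bsub>?G\<^esub> g' \<otimes>\<^bsub>?G\<^esub> (k' \<otimes>\<^bsub>?G\<^esub> inv\<^bsub>?G\<^esub> k)"
    using c g by simp
  moreover have "inv\<^bsub>?G\<^esub> h \<otimes>\<^bsub>?G\<^esub> h' \<in> H" "k' \<otimes>\<^bsub>?G\<^esub> inv\<^bsub>?G\<^esub> k \<in> K"
    using * H K by (auto intro: subgroup.m_closed subgroup.m_inv_closed)
  ultimately show ?thesis by (auto simp: GL_simps)
qed

text \<open>The integer bounds avoid truncation of \<open>r - n\<close>. In the converse direction
  the lower bound for \<open>k\<close> comes from \<open>r \<le> n + l\<close> and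
  \<open>l \<le> k\<close>.\<close>

lemma admissible_iff:
  "max 0 (int r - int n) \<le> int k \<and> k \<le> min r n \<and>
    max 0 (int r - int n) \<le> int l \<and> l \<le> min k (r - k) \<longleftrightarrow>
    l \<le> k \<and> l \<le> r - k \<and> k \<le> r \<and> r \<le> n + l \<and> k \<le> n"
proof -
  have *: "int r - int n \<le> int x \<longleftrightarrow> r \<le> n + x" for x by linarith
  have "r \<le> n + l \<Longrightarrow> l \<le> k \<Longrightarrow> r \<le> n + k" by (erule order_trans) simp
  moreover have "0 \<le> int x" for x by (rule of_nat_0_le_iff)
  ultimately show ?thesis unfolding max.bounded_iff min.bounded_iff * by blast
qed

theorem theorem1p1:
  fixes n r :: nat
  assumes "1 \<le> r" and "r < 2 * n"
  shows "complete_double_coset_reps (GL TYPE('a::field) (2 * n))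
    (shalika_subgroup TYPE('a) n) (parabolic_subgroup TYPE('a) r (2 * n - r))
    {w_mat TYPE('a) n r k l | k l.
       max 0 (int r - int n) \<le> int k \<and> k \<le> min r n \<and>
       max 0 (int r - int n) \<le> int l \<and> l \<le> min k (r - k)}"
proof -
  have r: "r \<le> n + n" using assms by simp
  define C where "C = {w_mat TYPE('a) n r k l | k l.
    l \<le> k \<and> l \<le> r - k \<and> k \<le> r \<and> r \<le> n + l \<and> k \<le> n}"
  have "{w_mat TYPE('a) n r k l | k l.
       max 0 (int r - int n) \<le> int k \<and> k \<le> min r n \<and>
       max 0 (int r - int n) \<le> int l \<and> l \<le> min k (r - k)} = C"
    unfolding C_def admissible_iff ..
  moreover have "complete_double_coset_reps (GL TYPE('a) (n + n))
    (shalika_subgroup TYPE('a) n) (parabolic_subgroup TYPE('a) r (n + n - r)) C"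
    unfolding complete_double_coset_reps_def
  proof (intro conjI)
    show G: "group (GL TYPE('a) (n + n))" by (rule group_GL)
    show S: "subgroup (shalika_subgroup TYPE('a) n) (GL TYPE('a) (n + n))" by (rule subgroup_shalika)
    show P: "subgroup (parabolic_subgroup TYPE('a) r (n + n - r)) (GL TYPE('a) (n + n))"
      using subgroup_parabolic[of r "n + n - r", where 'a = 'a] r by simp
    show C: "C \<subseteq> carrier (GL TYPE('a) (n + n))" unfolding C_def by (auto intro: w_mat_GL)
    show "carrier (GL TYPE('a) (n + n)) = (\<Union>g\<in>C. double_coset (GL TYPE('a) (n + n))
      (shalika_subgroup TYPE('a) n) g (parabolic_subgroup TYPE('a) r (n + n - r)))"
    proof (intro equalityI subsetI)
      fix x assume "x \<in> carrier (GL TYPE('a) (n + n))"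
      from w_mat_double_coset_cover[OF this r] obtain k l where kl: "l \<le> k" "l \<le> r - k" "k \<le> r" "r \<le> n + l" "k \<le> n"
        and x: "\<exists>s \<in> shalika_subgroup TYPE('a) n. \<exists>p \<in> parabolic_subgroup TYPE('a) r (n + n - r).
          x = s * w_mat TYPE('a) n r k l * p" .
      have "w_mat TYPE('a) n r k l \<in> C" unfolding C_def using kl by blast
      with x show "x \<in> (\<Union>g\<in>C. double_coset (GL TYPE('a) (n + n))
          (shalika_subgroup TYPE('a) n) g (parabolic_subgroup TYPE('a) r (n + n - r)))"
        unfolding UN_iff double_coset_GL_iff by blast
    next
      fix x assume "x \<in> (\<Union>g\<in>C. double_coset (GL TYPE('a) (n + n))
          (shalika_subgroup TYPE('a) n) g (parabolic_subgroup TYPE('a) r (n + n - r)))"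
      then obtain g s p where *: "g \<in> C" "s \<in> shalika_subgroup TYPE('a) n"
        "p \<in> parabolic_subgroup TYPE('a) r (n + n - r)" and x: "x = s * g * p"
        unfolding UN_iff double_coset_GL_iff by blast
      show "x \<in> carrier (GL TYPE('a) (n + n))"
        unfolding x
        by (intro mult_GL subgroup.mem_carrier[OF S *(2)] subsetD[OF C *(1)] subgroup.mem_carrier[OF P *(3)])
    qed
    show "disjoint_family_on (\<lambda>g. double_coset (GL TYPE('a) (n + n))
      (shalika_subgroup TYPE('a) n) g (parabolic_subgroup TYPE('a) r (n + n - r))) C"
      unfolding disjoint_family_on_def
    proof (intro ballI impI equals0I, elim IntE)
      fix g g' x
      assume g: "g \<in> C" and g': "g' \<in> C" and "g \<noteq> g'"
        and x: "x \<in> double_coset (GL TYPE('a) (n + n)) (shalika_subgroup TYPE('a) n) g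
          (parabolic_subgroup TYPE('a) r (n + n - r))"
        and x': "x \<in> double_coset (GL TYPE('a) (n + n)) (shalika_subgroup TYPE('a) n) g'
          (parabolic_subgroup TYPE('a) r (n + n - r))"
      note gc = subsetD[OF C g] subsetD[OF C g']
      obtain k l where kl: "l \<le> k" "l \<le> r - k" "k \<le> r" "r \<le> n + l" "k \<le> n"
        and gw: "g = w_mat TYPE('a) n r k l" using g unfolding C_def by blast
      obtain k' l' where kl': "l' \<le> k'" "l' \<le> r - k'" "k' \<le> r" "r \<le> n + l'" "k' \<le> n"
        and gw': "g' = w_mat TYPE('a) n r k' l'" using g' unfolding C_def by blast
      obtain s p where "s \<in> shalika_subgroup TYPE('a) n"
        "p \<in> parabolic_subgroup TYPE('a) r (n + n - r)" "g = s * g' * p"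
        using double_coset_overlap[OF S P gc x x'] by blast
      note 1 = w_mat_same_double_coset_le[OF kl kl' this[unfolded gw gw']]
      obtain s p where "s \<in> shalika_subgroup TYPE('a) n"
        "p \<in> parabolic_subgroup TYPE('a) r (n + n - r)" "g' = s * g * p"
        using double_coset_overlap[OF S P gc(2,1) x' x] by blast
      note 2 = w_mat_same_double_coset_le[OF kl' kl this[unfolded gw gw']]
      \<comment> \<open>The rank of N W determines \<open>k\<close> since \<open>k \<le> r\<close>;
        the second rank then determines \<open>l\<close>.\<close>
      have "r - k = r - k'" using 1(1) 2(1) by (rule order_antisym)
      then have k: "k = k'" using kl(3) kl'(3) by (metis diff_diff_cancel)
      have "r + r - k - l = r + r - k - l'" using 1(2) 2(2) unfolding k by (rule order_antisym)
      \<comment> \<open>Cancelling a truncated difference needs \<open>l\<close> and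
        \<open>l'\<close> below \<open>r + r - k\<close>, which follows from
        \<open>l \<le> r - k\<close>.\<close>
      moreover have "r - k \<le> r + r - k" by (rule diff_le_mono) simp
      then have "l \<le> r + r - k" "l' \<le> r + r - k"
        using kl(2) kl'(2) unfolding k by (blast intro: order_trans)+
      ultimately have "l = l'" by (metis diff_diff_cancel)
      with \<open>g \<noteq> g'\<close> k show False unfolding gw gw' by simp
    qed
  qed
  ultimately show ?thesis by (simp only: mult_2)
qed

end
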